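(* Let $G$ be a group, let $\mathcal{B}\subseteq\mathcal{B}^{\mathrm{st}}_G$ be a left-invariant Boolean algebra, and suppose $G^0_{\mathcal{B}}$ has finite index in $G$. Let $\mu$ be the unique bi-invariant probability measure on $\mathcal{B}^{\mathrm{st}}_G$. \begin{enumerate} \item[(1)] (a) The map $p\mapsto pG^0_{\mathcal{B}}$ is a bijection from $S^g(\mathcal{B})$ to the set $G/G^0_{\mathcal{B}}$ of left cosets, preserving the left actions of $G$. (b) If $p\in S^g(\mathcal{B})$ then $\operatorname{Stab}(p)=aG^0_{\mathcal{B}}a^{-1}$ for some (equivalently, any) $a\in pG^0_{\mathcal{B}}$. \item[(2)] If $X\in\mathcal{B}$ then for every left coset $C$ of $G^0_{\mathcal{B}}$, either $\mu(C\cap X)=0$ or $\mu(C\setminus X)=0$. Moreover, if $\mathcal{C}$ is the set of left cosets $C$ of $G^0_{\mathcal{B}}$ with $\mu(C\cap X)>0$ and $Y=\bigcup\mathcal{C}$, then $\mu(X)=\mu(Y)=|\mathcal{C}|/[G:G^0_{\mathcal{B}}]$. \item[(3)] If $X\in\mathcal{B}$ then $\operatorname{Stab}_\mu(X)$ is a finite-index subgroup of $G$ belonging to $\mathcal{B}^\sharp$. Moreover, \[G^0_{\mathcal{B}^\sharp}=\bigcap_{a\in G}aG^0_{\mathcal{B}}a^{-1}=\bigcap_{p\in S^g(\mathcal{B})}\operatorname{Stab}(p)=\bigcap_{X\in\mathcal{B}}\operatorname{Stab}_\mu(X),\] and so $G^0_{\mathcal{B}^\sharp}$ is a finite-index normal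 subgroup of $G$ belonging to $\mathcal{B}^\sharp$. \item[(4)] Assume $\mathcal{B}$ is bi-invariant. Then $G^0_{\mathcal{B}}$ is normal and the map in (1)(a) is a group isomorphism from $(S^g(\mathcal{B}),\ast)$ to $G/G^0_{\mathcal{B}}$. Moreover, $\operatorname{Stab}(p)=G^0_{\mathcal{B}}$ for every $p\in S^g(\mathcal{B})$, and $\operatorname{Stab}_\mu(X)$ is a finite-index subgroup of $G$ belonging to $\mathcal{B}$ for every $X\in\mathcal{B}$. \end{enumerate}
   Context: $A\subseteq G$ is stable in $G$ if there do not exist an infinite linear order $I$ and sequences $(a_i),(b_i)$ in $G$ with $a_ib_j\in A$ iff $i\le j$; $\mathcal{B}^{\mathrm{st}}_G$ is the Boolean algebra of stable subsets. $A$ is generic if $G=FA$ for a finite $F\subseteq G$. Left-invariant: $gA\in\mathcal{B}$ for $g\in G$, $A\in\mathcal{B}$; bi-invariant: also $Ag\in\mathcal{B}$; $\mathcal{B}^\sharp$ is the smallest bi-invariant Boolean algebra containing $\mathcal{B}$. For a Boolean algebra $\mathcal{C}$ of subsets of $G$, $G^0_{\mathcal{C}}$ is the intersection of all finite-index subgroups of $G$ belonging to $\mathcal{C}$. A $\mathcal{B}$-type is $p\subseteq\mathcal{B}$ with $\emptyset\notin p$, closed under finite intersections, and for each $A\in\mathcal{B}$ either $A\in p$ or $G\setminus A\in p$; $S^g(\mathcal{B})$ is the set of types all of whose members are generic. $G$ acts on types by $gp=\{gA:A\in p\}$, and $\operatorname{Stab}(p)=\{g\in G:gp=p\}$. For a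 finite-index subgroup $H\in\mathcal{B}$ and a type $p$, $pH$ is the unique left coset of $H$ in $p$. For a bi-invariant $\mathcal{B}$ and types $p,q$, $p\ast q=\{A\in\mathcal{B}:dq(A)\in p\}$ with $dq(A)=\{x:x^{-1}A\in q\}$. A probability measure is a finitely additive $\mu:\mathcal{B}^{\mathrm{st}}_G\to[0,1]$ with $\mu(G)=1$; it is a fact that there is exactly one bi-invariant one. For $X\in\mathcal{B}$, $\operatorname{Stab}_\mu(X)=\{g\in G:\mu(gX\,\triangle\,X)=0\}$. *)

theory Defs
  imports "HOL-Algebra.Left_Coset" "HOL-Analysis.Measure_Space"
begin

text \<open>
  The index order in the definition of stability may be any infinite linear order. Since HOL
  cannot quantify over types inside a definition, the indices are taken from the type of the group
  elements; \<open>stable_in_any_index\<close> shows that this excludes index orders on every type.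
\<close>

definition stable_in :: "('a, 'b) monoid_scheme \<Rightarrow> 'a set \<Rightarrow> bool" where
  "stable_in G A \<longleftrightarrow>
     \<not> (\<exists>(I :: 'a set) r a b. infinite I \<and> linear_order_on I r \<and>
          a \<in> I \<rightarrow> carrier G \<and> b \<in> I \<rightarrow> carrier G \<and>
          (\<forall>i\<in>I. \<forall>j\<in>I. a i \<otimes>\<^bsub>G\<^esub> b j \<in> A \<longleftrightarrow> (i, j) \<in> r))"

lemma stable_in_any_index:
  fixes I :: "'i set" and a b :: "'i \<Rightarrow> 'a"
  assumes st: "stable_in G A"
    and inf: "infinite I" and lin: "linear_order_on I r"
    and a: "a \<in> I \<rightarrow> carrier G" and b: "b \<in> I \<rightarrow> carrier G"
    and ab: "\<forall>i\<in>I. \<forall>j\<in>I. a i \<otimes>\<^bsub>G\<^esub> b j \<in> A \<longleftrightarrow> (i, j) \<in> r"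
  shows False
proof -
  have refl: "(i, i) \<in> r" if "i \<in> I" for i
    using lin that by (auto simp: order_on_defs refl_on_def)
  have anti: "i = j" if "(i, j) \<in> r" "(j, i) \<in> r" for i j
    using lin that unfolding order_on_defs by (meson antisymD)
  have trans: "(i, k) \<in> r" if "(i, j) \<in> r" "(j, k) \<in> r" for i j k
    using lin that unfolding order_on_defs by (meson transD)
  have total: "(i, j) \<in> r \<or> (j, i) \<in> r" if "i \<in> I" "j \<in> I" "i \<noteq> j" for i j
    using lin that by (auto simp: order_on_defs total_on_def)
  have inj: "inj_on a I"
  proof (rule inj_onI)
    fix i j assume ij: "i \<in> I" "j \<in> I" "a i = a j"
    have "(i, j) \<in> r" using ab ij refl[of j] by metis
    moreover have "(j, i) \<in> r" using ab ij refl[of i] by metis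
    ultimately show "i = j" by (rule anti)
  qed
  define c where "c = inv_into I a"
  define R where "R = {(x, y). x \<in> a ` I \<and> y \<in> a ` I \<and> (c x, c y) \<in> r}"
  have cI: "c x \<in> I" "a (c x) = x" if "x \<in> a ` I" for x
    using that by (auto simp: c_def inv_into_into f_inv_into_f)
  have "linear_order_on (a ` I) R"
    unfolding order_on_defs
  proof (intro conjI)
    show "refl_on (a ` I) R" using refl cI by (auto simp: refl_on_def R_def)
    show "Relation.trans R"
    proof (rule transI)
      fix x y z assume "(x, y) \<in> R" "(y, z) \<in> R"
      then show "(x, z) \<in> R" using trans[of "c x" "c y" "c z"] by (simp add: R_def)
    qed
    show "antisym R"
    proof (rule antisymI)
      fix x y assume xy: "(x, y) \<in> R" "(y, x) \<in> R"
      then have "c x = c y" using anti[of "c x" "c y"] by (simp add: R_def)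
      moreover have "x \<in> a ` I" "y \<in> a ` I" using xy(1) by (simp_all add: R_def)
      ultimately show "x = y" using cI(2) by metis
    qed
    show "total_on (a ` I) R"
    proof (rule total_onI)
      fix x y assume xy: "x \<in> a ` I" "y \<in> a ` I" "x \<noteq> y"
      then have "c x \<noteq> c y" using cI(2)[of x] cI(2)[of y] by metis
      then show "(x, y) \<in> R \<or> (y, x) \<in> R"
        using total[OF cI(1) cI(1), OF xy(1,2)] xy by (simp add: R_def)
    qed
    show "R \<subseteq> a ` I \<times> a ` I" by (auto simp: R_def)
  qed
  moreover have "infinite (a ` I)" using inf inj finite_imageD by blast
  moreover have "(\<lambda>x. x) \<in> a ` I \<rightarrow> carrier G" using a by auto
  moreover have "(\<lambda>x. b (c x)) \<in> a ` I \<rightarrow> carrier G" using b cI by auto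
  moreover have "\<forall>x\<in>a ` I. \<forall>y\<in>a ` I. x \<otimes>\<^bsub>G\<^esub> b (c y) \<in> A \<longleftrightarrow> (x, y) \<in> R"
  proof (intro ballI)
    fix x y assume xy: "x \<in> a ` I" "y \<in> a ` I"
    have "a (c x) \<otimes>\<^bsub>G\<^esub> b (c y) \<in> A \<longleftrightarrow> (c x, c y) \<in> r"
      using ab cI(1)[OF xy(1)] cI(1)[OF xy(2)] by blast
    then show "x \<otimes>\<^bsub>G\<^esub> b (c y) \<in> A \<longleftrightarrow> (x, y) \<in> R"
      using xy cI(2)[OF xy(1)] by (simp add: R_def)
  qed
  ultimately show False using st unfolding stable_in_def by (elim notE, intro exI conjI)
qed

definition stable_sets :: "('a, 'b) monoid_scheme \<Rightarrow> 'a set set" where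
  "stable_sets G = {A. A \<subseteq> carrier G \<and> stable_in G A}"

definition generic_in :: "('a, 'b) monoid_scheme \<Rightarrow> 'a set \<Rightarrow> bool" where
  "generic_in G A \<longleftrightarrow> (\<exists>F. finite F \<and> F \<subseteq> carrier G \<and> carrier G = F <#>\<^bsub>G\<^esub> A)"

definition left_invariant_algebra :: "('a, 'b) monoid_scheme \<Rightarrow> 'a set set \<Rightarrow> bool" where
  "left_invariant_algebra G B \<longleftrightarrow>
     Sigma_Algebra.algebra (carrier G) B \<and> (\<forall>g\<in>carrier G. \<forall>A\<in>B. g <#\<^bsub>G\<^esub> A \<in> B)"

definition bi_invariant_algebra :: "('a, 'b) monoid_scheme \<Rightarrow> 'a set set \<Rightarrow> bool" where
  "bi_invariant_algebra G B \<longleftrightarrow>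
     left_invariant_algebra G B \<and> (\<forall>g\<in>carrier G. \<forall>A\<in>B. A #>\<^bsub>G\<^esub> g \<in> B)"

definition bi_invariant_hull :: "('a, 'b) monoid_scheme \<Rightarrow> 'a set set \<Rightarrow> 'a set set" where
  "bi_invariant_hull G B = \<Inter>{C. bi_invariant_algebra G C \<and> B \<subseteq> C}"

definition finite_index_subgroup :: "('a, 'b) monoid_scheme \<Rightarrow> 'a set \<Rightarrow> bool" where
  "finite_index_subgroup G H \<longleftrightarrow> subgroup H G \<and> finite (lcosets\<^bsub>G\<^esub> H)"

text \<open>\<open>G\<^sup>0\<^sub>C\<close>; the family is nonempty for an algebra \<open>C\<close>, as it contains the whole group.\<close>

definition component :: "('a, 'b) monoid_scheme \<Rightarrow> 'a set set \<Rightarrow> 'a set" where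
  "component G C = \<Inter>{H. finite_index_subgroup G H \<and> H \<in> C}"

definition conjugate :: "('a, 'b) monoid_scheme \<Rightarrow> 'a \<Rightarrow> 'a set \<Rightarrow> 'a set" where
  "conjugate G a H = a <#\<^bsub>G\<^esub> H #>\<^bsub>G\<^esub> inv\<^bsub>G\<^esub> a"

definition is_type :: "('a, 'b) monoid_scheme \<Rightarrow> 'a set set \<Rightarrow> 'a set set \<Rightarrow> bool" where
  "is_type G B p \<longleftrightarrow>
     p \<subseteq> B \<and> {} \<notin> p \<and> (\<forall>A\<in>p. \<forall>A'\<in>p. A \<inter> A' \<in> p) \<and>
     (\<forall>A\<in>B. A \<in> p \<or> carrier G - A \<in> p)"

definition generic_types :: "('a, 'b) monoid_scheme \<Rightarrow> 'a set set \<Rightarrow> 'a set set set" where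
  "generic_types G B = {p. is_type G B p \<and> (\<forall>A\<in>p. generic_in G A)}"

definition type_act :: "('a, 'b) monoid_scheme \<Rightarrow> 'a \<Rightarrow> 'a set set \<Rightarrow> 'a set set" where
  "type_act G g p = (\<lambda>A. g <#\<^bsub>G\<^esub> A) ` p"

definition type_stab :: "('a, 'b) monoid_scheme \<Rightarrow> 'a set set \<Rightarrow> 'a set" where
  "type_stab G p = {g \<in> carrier G. type_act G g p = p}"

definition type_coset :: "('a, 'b) monoid_scheme \<Rightarrow> 'a set \<Rightarrow> 'a set set \<Rightarrow> 'a set" where
  "type_coset G H p = (THE C. C \<in> lcosets\<^bsub>G\<^esub> H \<and> C \<in> p)"

definition type_def_set :: "('a, 'b) monoid_scheme \<Rightarrow> 'a set set \<Rightarrow> 'a set \<Rightarrow> 'a set" where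
  "type_def_set G q A = {x \<in> carrier G. inv\<^bsub>G\<^esub> x <#\<^bsub>G\<^esub> A \<in> q}"

definition type_prod ::
    "('a, 'b) monoid_scheme \<Rightarrow> 'a set set \<Rightarrow> 'a set set \<Rightarrow> 'a set set \<Rightarrow> 'a set set" where
  "type_prod G B p q = {A \<in> B. type_def_set G q A \<in> p}"

text \<open>The unit field is whatever two-sided identity the product has; it carries no extra data.\<close>

definition generic_type_group ::
    "('a, 'b) monoid_scheme \<Rightarrow> 'a set set \<Rightarrow> 'a set set monoid" where
  "generic_type_group G B =
     \<lparr>carrier = generic_types G B,
      mult = type_prod G B,
      one = (THE e. e \<in> generic_types G B \<and>
               (\<forall>p\<in>generic_types G B. type_prod G B e p = p \<and> type_prod G B p e = p))\<rparr>"

text \<open>Values of \<open>\<mu>\<close> outside \<open>stable_sets G\<close> are irrelevant.\<close>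

definition bi_invariant_probability ::
    "('a, 'b) monoid_scheme \<Rightarrow> ('a set \<Rightarrow> real) \<Rightarrow> bool" where
  "bi_invariant_probability G \<mu> \<longleftrightarrow>
     (\<forall>A\<in>stable_sets G. \<mu> A \<in> {0..1}) \<and>
     additive (stable_sets G) \<mu> \<and>
     \<mu> (carrier G) = 1 \<and>
     (\<forall>g\<in>carrier G. \<forall>A\<in>stable_sets G.
        \<mu> (g <#\<^bsub>G\<^esub> A) = \<mu> A \<and> \<mu> (A #>\<^bsub>G\<^esub> g) = \<mu> A)"

definition measure_stab ::
    "('a, 'b) monoid_scheme \<Rightarrow> ('a set \<Rightarrow> real) \<Rightarrow> 'a set \<Rightarrow> 'a set" where
  "measure_stab G \<mu> X = {g \<in> carrier G. \<mu> (sym_diff (g <#\<^bsub>G\<^esub> X) X) = 0}"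

end

theory Submission
  imports Defs "HOL-Library.Ramsey"
begin

text \<open>
  Call a stable set of positive measure \<open>W\<close> unsplit by a stable set \<open>X\<close> if every right translate of
  \<open>X\<close> contains or avoids \<open>W\<close> up to a null set. Such a \<open>W\<close> exists: repeated splitting would give a
  binary tree over countably many points and translates, each of whose continuum many branches is
  definable from finitely many points by stability, which is impossible by counting. Stable sets of
  positive measure are generic on both sides, since otherwise an intersection argument for the
  measure produces a half graph. Hence finitely many right translates of \<open>W\<close> cover \<open>G\<close>, and
  \<open>{h. \<mu> (X h \<triangle> X) = 0}\<close> has finite index. By definability of the translates of \<open>W\<close> as types, it
  lies in every left-invariant algebra that contains \<open>X\<close>, so it contains \<open>G\<^sup>0\<close>. Right genericity then
  makes \<open>X\<close> null or conull on each left coset of \<open>G\<^sup>0\<close>, and everything else is computed from cosets.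
  The component of the bi-invariant hull is the normal core \<open>N\<close> of \<open>G\<^sup>0\<close>, because the stable sets that
  are null or conull on every coset of \<open>N\<close> form a bi-invariant algebra.
\<close>

section \<open>Stable relations\<close>

text \<open>The algebra \<open>B\<close> is closed under left translation only, and this decides
  which side each argument uses. For \<open>X \<in> B\<close> the sets
  \<open>{b. a \<otimes> b \<in> X}\<close> are left translates of \<open>X\<close> and lie in
  \<open>B\<close>, whereas the sets \<open>{a. a \<otimes> b \<in> X}\<close> are right translates
  and are merely stable. The unsplit set is therefore a set of points \<open>a\<close>, and
  definability transfers the information to the parameters \<open>b\<close>, where it yields members
  of \<open>B\<close>. The subgroup obtained in this way is a finite-index member of
  \<open>B\<close>, hence one of those intersected in the component; this is how an intersection
  defined abstractly comes to control every \<open>X \<in> B\<close>. The measure is only finitely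
  additive, so no limits of decreasing sets are available. Points are extracted from finite
  intersections only, and unsplit sets of positive measure stand in for complete types, whose
  existence would call for ultrafilters.\<close>

lemma Ramsey_nat_pairs:
  fixes P :: "nat \<Rightarrow> nat \<Rightarrow> bool"
  obtains s c where "strict_mono (s :: nat \<Rightarrow> nat)" "\<And>i j. i < j \<Longrightarrow> P (s i) (s j) = c"
proof -
  define f where "f X = (if P (Min X) (Max X) then 0 else 1 :: nat)" for X
  have "\<exists>Y t. Y \<subseteq> UNIV \<and> infinite Y \<and> t < 2 \<and> (\<forall>x\<in>Y. \<forall>y\<in>Y. x \<noteq> y \<longrightarrow> f {x, y} = t)"
    by (rule Ramsey2) (auto simp: f_def)
  then obtain Y t where Y: "infinite Y"
    and t: "\<And>x y. x \<in> Y \<Longrightarrow> y \<in> Y \<Longrightarrow> x \<noteq> y \<Longrightarrow> f {x, y} = t"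
    by auto
  define s where "s = enumerate Y"
  have s: "strict_mono s"
    unfolding s_def using Y by (rule strict_mono_enumerate)
  have "P (s i) (s j) = (t = 0)" if "i < j" for i j
  proof -
    have lt: "s i < s j" using s that by (simp add: strict_mono_less)
    have "s i \<in> Y" "s j \<in> Y" using Y by (auto simp: s_def enumerate_in_set)
    then have "f {s i, s j} = t" using t lt by simp
    moreover have "f {s i, s j} = (if P (s i) (s j) then 0 else 1)"
      using lt by (simp add: f_def)
    ultimately show ?thesis by (auto split: if_splits)
  qed
  then show thesis by (rule that[OF s])
qed

text \<open>A half graph over \<open>nat\<close> is forbidden in both orientations at once through
  \<open>c\<close>, and its diagonal is left free. Half graphs of this form survive passing to
  subsequences, negating the relation and exchanging the two sides.\<close>

definition pair_stable :: "'x set \<Rightarrow> 'y set \<Rightarrow> ('x \<Rightarrow> 'y \<Rightarrow> bool) \<Rightarrow> bool" where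
  "pair_stable D T R \<longleftrightarrow>
     \<not> (\<exists>a b c. (\<forall>i::nat. a i \<in> D \<and> b i \<in> T) \<and>
          (\<forall>i j. i < j \<longrightarrow> R (a i) (b j) = c \<and> R (a j) (b i) = (\<not> c)))"

lemma pair_stableD:
  assumes "pair_stable D T R" "\<And>i::nat. a i \<in> D" "\<And>i. b i \<in> T"
    and "\<And>i j. i < j \<Longrightarrow> R (a i) (b j) = c" "\<And>i j. i < j \<Longrightarrow> R (a j) (b i) = (\<not> c)"
  shows False
proof -
  have "\<exists>a b c. (\<forall>i::nat. a i \<in> D \<and> b i \<in> T) \<and>
          (\<forall>i j. i < j \<longrightarrow> R (a i) (b j) = c \<and> R (a j) (b i) = (\<not> c))"
    by (rule exI[of _ a], rule exI[of _ b], rule exI[of _ c]) (simp add: assms(2-))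
  then show False using assms(1) unfolding pair_stable_def by contradiction
qed

lemma pair_stable_mono:
  assumes "pair_stable D T R" "D' \<subseteq> D" "T' \<subseteq> T"
  shows "pair_stable D' T' R"
  unfolding pair_stable_def
proof clarify
  fix a b c
  assume "\<forall>i::nat. a i \<in> D' \<and> b i \<in> T'"
    and "\<forall>i j. i < j \<longrightarrow> R (a i) (b j) = c \<and> R (a j) (b i) = (\<not> c)"
  then show False
    using assms by (intro pair_stableD[of D T R a b c]) auto
qed

lemma pair_stable_cong:
  assumes "\<And>x y. x \<in> D \<Longrightarrow> y \<in> T \<Longrightarrow> R x y = R' x y"
  shows "pair_stable D T R = pair_stable D T R'"
  unfolding pair_stable_def using assms by (intro arg_cong[of _ _ Not] ex_cong1) auto

lemma pair_stable_not:
  assumes "pair_stable D T R"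
  shows "pair_stable D T (\<lambda>x y. \<not> R x y)"
  unfolding pair_stable_def
proof clarify
  fix a b c
  assume "\<forall>i::nat. a i \<in> D \<and> b i \<in> T"
    and "\<forall>i j. i < j \<longrightarrow> (\<not> R (a i) (b j)) = c \<and> (\<not> R (a j) (b i)) = (\<not> c)"
  then show False
    using assms by (intro pair_stableD[of D T R a b "\<not> c"]) auto
qed

lemma pair_stable_swap:
  assumes "pair_stable D T R"
  shows "pair_stable T D (\<lambda>y x. R x y)"
  unfolding pair_stable_def
proof clarify
  fix b a c
  assume "\<forall>i::nat. b i \<in> T \<and> a i \<in> D"
    and "\<forall>i j. i < j \<longrightarrow> R (a j) (b i) = c \<and> R (a i) (b j) = (\<not> c)"
  then show False
    using assms by (intro pair_stableD[of D T R a b "\<not> c"]) auto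
qed

lemma pair_stable_image:
  assumes "pair_stable D T R" "f ` D' \<subseteq> D" "g ` T' \<subseteq> T"
  shows "pair_stable D' T' (\<lambda>x y. R (f x) (g y))"
  unfolding pair_stable_def
proof clarify
  fix a b c
  assume "\<forall>i::nat. a i \<in> D' \<and> b i \<in> T'"
    and "\<forall>i j. i < j \<longrightarrow> R (f (a i)) (g (b j)) = c \<and> R (f (a j)) (g (b i)) = (\<not> c)"
  then show False
    using assms by (intro pair_stableD[of D T R "\<lambda>i. f (a i)" "\<lambda>i. g (b i)" c]) auto
qed

text \<open>Four applications of Ramsey make \<open>R\<close> and \<open>S\<close> constant above
  and below the diagonal, with colours \<open>c1\<close>, \<open>c2\<close> for \<open>R\<close> and
  \<open>c3\<close>, \<open>c4\<close> for \<open>S\<close>. If neither relation were a half graph,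
  then \<open>c1 = c2\<close> and \<open>c3 = c4\<close>, and the conjunction would have the same
  colour on both sides of the diagonal.\<close>

lemma pair_stable_conj:
  assumes R: "pair_stable D T R" and S: "pair_stable D T S"
  shows "pair_stable D T (\<lambda>x y. R x y \<and> S x y)"
  unfolding pair_stable_def
proof clarify
  fix a b c
  assume ab: "\<forall>i::nat. a i \<in> D \<and> b i \<in> T"
    and c: "\<forall>i j. i < j \<longrightarrow>
      (R (a i) (b j) \<and> S (a i) (b j)) = c \<and> (R (a j) (b i) \<and> S (a j) (b i)) = (\<not> c)"
  obtain s1 :: "nat \<Rightarrow> nat" and c1 where s1: "strict_mono s1"
    and c1: "\<And>i j. i < j \<Longrightarrow> R (a (s1 i)) (b (s1 j)) = c1"
    by (rule Ramsey_nat_pairs[of "\<lambda>i j. R (a i) (b j)"]) (rule that)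
  obtain s2 :: "nat \<Rightarrow> nat" and c2 where s2: "strict_mono s2"
    and c2: "\<And>i j. i < j \<Longrightarrow> R (a (s1 (s2 j))) (b (s1 (s2 i))) = c2"
    by (rule Ramsey_nat_pairs[of "\<lambda>i j. R (a (s1 j)) (b (s1 i))"]) (rule that)
  obtain s3 :: "nat \<Rightarrow> nat" and c3 where s3: "strict_mono s3"
    and c3: "\<And>i j. i < j \<Longrightarrow> S (a (s1 (s2 (s3 i)))) (b (s1 (s2 (s3 j)))) = c3"
    by (rule Ramsey_nat_pairs[of "\<lambda>i j. S (a (s1 (s2 i))) (b (s1 (s2 j)))"]) (rule that)
  obtain s4 :: "nat \<Rightarrow> nat" and c4 where s4: "strict_mono s4"
    and c4: "\<And>i j. i < j \<Longrightarrow> S (a (s1 (s2 (s3 (s4 j))))) (b (s1 (s2 (s3 (s4 i))))) = c4"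
    by (rule Ramsey_nat_pairs[of "\<lambda>i j. S (a (s1 (s2 (s3 j)))) (b (s1 (s2 (s3 i))))"]) (rule that)
  define s where "s i = s1 (s2 (s3 (s4 i)))" for i
  note less = strict_mono_less[OF s1] strict_mono_less[OF s2] strict_mono_less[OF s3]
    strict_mono_less[OF s4]
  have cs: "(R (a (s i)) (b (s j)) \<and> S (a (s i)) (b (s j))) = c"
    "(R (a (s j)) (b (s i)) \<and> S (a (s j)) (b (s i))) = (\<not> c)" if "i < j" for i j
    using c that by (simp_all add: s_def less)
  have col: "R (a (s i)) (b (s j)) = c1" "R (a (s j)) (b (s i)) = c2"
    "S (a (s i)) (b (s j)) = c3" "S (a (s j)) (b (s i)) = c4" if "i < j" for i j
    using c1 c2 c3 c4 that by (simp_all add: s_def less)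
  have "(c1 \<and> c3) = c" "(c2 \<and> c4) = (\<not> c)"
    using cs[of 0 1] col[of 0 1] by simp_all
  then consider "c2 = (\<not> c1)" | "c4 = (\<not> c3)" by blast
  then show False
  proof cases
    case 1
    show False
      using ab col 1 by (intro pair_stableD[OF R, of "\<lambda>i. a (s i)" "\<lambda>i. b (s i)" c1]) auto
  next
    case 2
    show False
      using ab col 2 by (intro pair_stableD[OF S, of "\<lambda>i. a (s i)" "\<lambda>i. b (s i)" c3]) auto
  qed
qed

text \<open>A half graph with colour \<open>c\<close> is turned into the order \<le> or \<ge> on
  \<open>nat\<close>. Conversely, Ramsey finds a monotone sequence in any infinite linear order, and
  antisymmetry with totality supplies the opposite colour below the diagonal.\<close>

lemma stable_in_iff_pair_stable:
  "stable_in G A \<longleftrightarrow> pair_stable (carrier G) (carrier G) (\<lambda>x y. x \<otimes>\<^bsub>G\<^esub> y \<in> A)"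
proof
  assume st: "stable_in G A"
  show "pair_stable (carrier G) (carrier G) (\<lambda>x y. x \<otimes>\<^bsub>G\<^esub> y \<in> A)"
    unfolding pair_stable_def
  proof clarify
    fix a b :: "nat \<Rightarrow> 'a" and c
    assume ab: "\<forall>i. a i \<in> carrier G \<and> b i \<in> carrier G"
      and c: "\<forall>i j. i < j \<longrightarrow> (a i \<otimes>\<^bsub>G\<^esub> b j \<in> A) = c \<and> (a j \<otimes>\<^bsub>G\<^esub> b i \<in> A) = (\<not> c)"
    \<comment> \<open>interleaving makes the unknown diagonal entries disappear\<close>
    define r where "r = {(i, j :: nat). if c then i \<le> j else j \<le> i}"
    define a' where "a' i = (if c then a (2 * i) else a (2 * i + 1))" for i
    define b' where "b' i = (if c then b (2 * i + 1) else b (2 * i))" for i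
    have "linear_order_on UNIV r"
      by (auto simp: r_def order_on_defs refl_on_def total_on_def
            intro!: transI antisymI split: if_splits)
    moreover have "\<forall>i\<in>UNIV. \<forall>j\<in>UNIV. a' i \<otimes>\<^bsub>G\<^esub> b' j \<in> A \<longleftrightarrow> (i, j) \<in> r"
    proof (intro ballI)
      fix i j :: nat
      show "a' i \<otimes>\<^bsub>G\<^esub> b' j \<in> A \<longleftrightarrow> (i, j) \<in> r"
      proof (cases c)
        case True
        then show ?thesis
          using c[rule_format, of "2 * i" "2 * j + 1"] c[rule_format, of "2 * j + 1" "2 * i"]
          by (cases "i \<le> j") (auto simp: r_def a'_def b'_def)
      next
        case False
        then show ?thesis
          using c[rule_format, of "2 * i + 1" "2 * j"] c[rule_format, of "2 * j" "2 * i + 1"]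
          by (cases "j \<le> i") (auto simp: r_def a'_def b'_def)
      qed
    qed
    moreover have "a' \<in> UNIV \<rightarrow> carrier G" "b' \<in> UNIV \<rightarrow> carrier G"
      using ab by (auto simp: a'_def b'_def)
    ultimately show False
      using stable_in_any_index[OF st infinite_UNIV_nat] by blast
  qed
next
  assume ps: "pair_stable (carrier G) (carrier G) (\<lambda>x y. x \<otimes>\<^bsub>G\<^esub> y \<in> A)"
  show "stable_in G A"
    unfolding stable_in_def
  proof clarify
    fix I :: "'a set" and r a b
    assume I: "infinite I" and lin: "linear_order_on I r"
      and ab: "a \<in> I \<rightarrow> carrier G" "b \<in> I \<rightarrow> carrier G"
      and r: "\<forall>i\<in>I. \<forall>j\<in>I. (a i \<otimes>\<^bsub>G\<^esub> b j \<in> A) = ((i, j) \<in> r)"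
    obtain f :: "nat \<Rightarrow> 'a" where f: "inj f" "range f \<subseteq> I"
      using I infinite_countable_subset by blast
    obtain s :: "nat \<Rightarrow> nat" and c where s: "strict_mono s" and c: "\<And>i j. i < j \<Longrightarrow> ((f (s i), f (s j)) \<in> r) = c"
      by (rule Ramsey_nat_pairs[of "\<lambda>i j. (f i, f j) \<in> r"]) (rule that)
    have fI: "f i \<in> I" for i using f by auto
    have c': "((f (s j), f (s i)) \<in> r) = (\<not> c)" if "i < j" for i j
    proof -
      have "s i < s j" using s that by (simp add: strict_mono_less)
      then have "f (s i) \<noteq> f (s j)" using f(1) by (auto dest: injD)
      then have "((f (s j), f (s i)) \<in> r) = (\<not> (f (s i), f (s j)) \<in> r)"
        using lin fI unfolding order_on_defs total_on_def antisym_def by metis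
      then show ?thesis using c[OF that] by simp
    qed
    show False
      using ab fI r c c'
      by (intro pair_stableD[OF ps, of "\<lambda>i. a (f (s i))" "\<lambda>i. b (f (s i))" c]) auto
  qed
qed

text \<open>Definability of types over a stable relation, in combinatorial form: a set that looks
  like a row on every finite set is separated from its complement by finitely many rows. If no
  finite \<open>F\<close> works, triples (a, b, c) are built in which earlier \<open>a\<close> fail
  to separate later \<open>b\<close> from later \<open>c\<close>, while later \<open>a\<close>
  separate all earlier ones. Ramsey applied to \<open>R (a i) (c j)\<close> then gives a half graph
  between \<open>a\<close> and \<open>c\<close> or between \<open>a\<close> and
  \<open>b\<close>.\<close>

lemma pair_stable_definable:
  assumes st: "pair_stable D T R" and Y: "Y \<subseteq> T"
    and close: "\<And>T0. finite T0 \<Longrightarrow> T0 \<subseteq> T \<Longrightarrow> \<exists>a\<in>D. \<forall>y\<in>T0. R a y \<longleftrightarrow> y \<in> Y"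
  obtains F where "finite F" "F \<subseteq> D" "\<And>b c. b \<in> Y \<Longrightarrow> c \<in> T - Y \<Longrightarrow> \<exists>a\<in>F. R a b \<and> \<not> R a c"
proof (rule ccontr)
  assume "\<not> thesis"
  then have bad: "\<exists>b\<in>Y. \<exists>c\<in>T - Y. \<forall>a\<in>F. R a b \<longrightarrow> R a c" if "finite F" "F \<subseteq> D" for F
    using that \<open>\<And>F. finite F \<Longrightarrow> F \<subseteq> D \<Longrightarrow> (\<And>b c. b \<in> Y \<Longrightarrow> c \<in> T - Y \<Longrightarrow> \<exists>a\<in>F. R a b \<and> \<not> R a c) \<Longrightarrow> thesis\<close>
    by meson
  \<comment> \<open>In each triple \<open>b\<close> and \<open>c\<close> are chosen before
    \<open>a\<close>: they form a pair that the previous \<open>a\<close> do not separate, and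
    \<open>a\<close> is then a point that agrees with \<open>Y\<close> on all previous
    \<open>b\<close> and \<open>c\<close>.\<close>
  define P where "P f n u \<longleftrightarrow> (case u of (a, b, c) \<Rightarrow> a \<in> D \<and> b \<in> Y \<and> c \<in> T - Y \<and>
     (\<forall>i<n. R (fst (f i)) b \<longrightarrow> R (fst (f i)) c) \<and>
     (\<forall>i<n. R a (fst (snd (f i))) \<and> \<not> R a (snd (snd (f i)))))"
    for f :: "nat \<Rightarrow> 'a \<times> 'b \<times> 'b" and n u
  have "\<exists>f. \<forall>n. P f n (f n)"
  proof (rule dependent_wellorder_choice)
    fix r and f g :: "nat \<Rightarrow> 'a \<times> 'b \<times> 'b" and n
    assume "\<And>y. y < n \<Longrightarrow> f y = g y"
    then show "P f n r = P g n r" by (simp add: P_def)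
  next
    fix n and f :: "nat \<Rightarrow> 'a \<times> 'b \<times> 'b"
    assume IH: "\<And>m. m < n \<Longrightarrow> P f m (f m)"
    have mem: "fst (f m) \<in> D" "fst (snd (f m)) \<in> Y" "snd (snd (f m)) \<in> T - Y" if "m < n" for m
      using IH[OF that] by (auto simp: P_def split: prod.splits)
    obtain b c where bc: "b \<in> Y" "c \<in> T - Y" "\<forall>a\<in>(fst \<circ> f) ` {..<n}. R a b \<longrightarrow> R a c"
      using bad[of "(fst \<circ> f) ` {..<n}"] mem by auto
    let ?T0 = "(fst \<circ> snd \<circ> f) ` {..<n} \<union> (snd \<circ> snd \<circ> f) ` {..<n}"
    have "\<exists>a\<in>D. \<forall>y\<in>?T0. R a y \<longleftrightarrow> y \<in> Y"
      using mem Y by (intro close) auto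
    then obtain a where "a \<in> D" "\<forall>y\<in>?T0. R a y \<longleftrightarrow> y \<in> Y" by blast
    then have "P f n (a, b, c)" using bc mem by (auto simp: P_def)
    then show "\<exists>r. P f n r" by blast
  qed
  then obtain f where f: "\<And>n. P f n (f n)" by blast
  define a b c where "a n = fst (f n)" and "b n = fst (snd (f n))" and "c n = snd (snd (f n))" for n
  have mem: "a n \<in> D" "b n \<in> T" "c n \<in> T" for n
    using f[of n] Y by (auto simp: P_def a_def b_def c_def split: prod.splits)
  have lo: "R (a i) (b j) \<Longrightarrow> R (a i) (c j)" and up: "R (a j) (b i)" "\<not> R (a j) (c i)" if "i < j" for i j
    using f[of j] that by (auto simp: P_def a_def b_def c_def split: prod.splits)
  obtain s :: "nat \<Rightarrow> nat" and d where s: "strict_mono s" and d: "\<And>i j. i < j \<Longrightarrow> R (a (s i)) (c (s j)) = d"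
    by (rule Ramsey_nat_pairs[of "\<lambda>i j. R (a i) (c j)"]) (rule that)
  note less = strict_mono_less[OF s]
  show False
  proof (cases d)
    case True
    show False
      using d up(2) True mem
      by (intro pair_stableD[OF st, of "\<lambda>i. a (s i)" "\<lambda>i. c (s i)" True]) (auto simp: less)
  next
    case False
    have "\<not> R (a (s i)) (b (s j))" if "i < j" for i j
      using lo[of "s i" "s j"] d[OF that] False that by (auto simp: less)
    then show False
      using up(1) mem
      by (intro pair_stableD[OF st, of "\<lambda>i. a (s i)" "\<lambda>i. b (s i)" False]) (auto simp: less)
  qed
qed

section \<open>Finitely additive probabilities and stable families\<close>

locale fin_additive_prob = Sigma_Algebra.algebra \<Omega> M
  for \<Omega> :: "'a set" and M +
  fixes \<mu> :: "'a set \<Rightarrow> real"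
  assumes nonneg: "A \<in> M \<Longrightarrow> 0 \<le> \<mu> A"
    and additive: "additive M \<mu>"
    and total: "\<mu> \<Omega> = 1"
begin

lemma measure_split:
  assumes "A \<in> M" "B \<in> M"
  shows "\<mu> A = \<mu> (A \<inter> B) + \<mu> (A - B)"
proof -
  have "\<mu> ((A \<inter> B) \<union> (A - B)) = \<mu> (A \<inter> B) + \<mu> (A - B)"
    using assms by (intro additiveD[OF additive]) auto
  then show ?thesis by (simp add: Int_Diff_Un)
qed

lemma measure_disjoint_Un:
  "A \<in> M \<Longrightarrow> B \<in> M \<Longrightarrow> A \<inter> B = {} \<Longrightarrow> \<mu> (A \<union> B) = \<mu> A + \<mu> B"
  using additiveD[OF additive] by blast

lemma measure_empty [simp]: "\<mu> {} = 0"
  using measure_split[of "{}" "{}"] by simp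

lemma measure_mono:
  assumes "A \<in> M" "B \<in> M" "A \<subseteq> B"
  shows "\<mu> A \<le> \<mu> B"
proof -
  have "B \<inter> A = A" using assms by blast
  then show ?thesis using measure_split[of B A] nonneg[of "B - A"] assms by auto
qed

lemma measure_le_1: "A \<in> M \<Longrightarrow> \<mu> A \<le> 1"
  using measure_mono[of A \<Omega>] total sets_into_space by auto

lemma null_subset: "\<lbrakk>A \<in> M; B \<in> M; A \<subseteq> B; \<mu> B = 0\<rbrakk> \<Longrightarrow> \<mu> A = 0"
  using measure_mono[of A B] nonneg[of A] by simp

lemma measure_Un_le:
  assumes "A \<in> M" "B \<in> M"
  shows "\<mu> (A \<union> B) \<le> \<mu> A + \<mu> B"
proof -
  have "\<mu> (A \<union> (B - A)) = \<mu> A + \<mu> (B - A)"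
    using assms by (intro measure_disjoint_Un) auto
  moreover have "\<mu> (B - A) \<le> \<mu> B" using assms by (intro measure_mono) auto
  ultimately show ?thesis by simp
qed

lemma null_Un: "\<lbrakk>A \<in> M; B \<in> M; \<mu> A = 0; \<mu> B = 0\<rbrakk> \<Longrightarrow> \<mu> (A \<union> B) = 0"
  using measure_Un_le[of A B] nonneg[of "A \<union> B"] by auto

lemma measure_UN_le:
  assumes "finite I" "\<And>i. i \<in> I \<Longrightarrow> A i \<in> M"
  shows "\<mu> (\<Union>i\<in>I. A i) \<le> (\<Sum>i\<in>I. \<mu> (A i))"
  using assms
proof (induction I rule: finite_induct)
  case (insert i I)
  have "\<mu> (A i \<union> (\<Union>i\<in>I. A i)) \<le> \<mu> (A i) + \<mu> (\<Union>i\<in>I. A i)"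
    using insert by (intro measure_Un_le finite_UN) auto
  then show ?case using insert by auto
qed simp

lemma null_UN:
  assumes "finite I" "\<And>i. i \<in> I \<Longrightarrow> A i \<in> M" "\<And>i. i \<in> I \<Longrightarrow> \<mu> (A i) = 0"
  shows "\<mu> (\<Union>i\<in>I. A i) = 0"
proof -
  have "\<mu> (\<Union>i\<in>I. A i) \<le> 0" using measure_UN_le[OF assms(1,2)] assms(3) by simp
  then show ?thesis using nonneg[of "\<Union>i\<in>I. A i"] assms(1,2) by (simp add: finite_UN)
qed

lemma measure_UN_disjoint:
  assumes "finite I" "\<And>i. i \<in> I \<Longrightarrow> A i \<in> M" "disjoint_family_on A I"
  shows "\<mu> (\<Union>i\<in>I. A i) = (\<Sum>i\<in>I. \<mu> (A i))"
  using assms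
proof (induction I rule: finite_induct)
  case (insert i I)
  have "A i \<inter> (\<Union>i\<in>I. A i) = {}"
    using insert.prems(2) insert.hyps by (auto simp: disjoint_family_on_def)
  then have "\<mu> (A i \<union> (\<Union>i\<in>I. A i)) = \<mu> (A i) + \<mu> (\<Union>i\<in>I. A i)"
    using insert by (intro measure_disjoint_Un finite_UN) auto
  moreover have "disjoint_family_on A I"
    using insert.prems(2) by (rule disjoint_family_on_mono[rotated]) auto
  ultimately show ?case using insert by auto
qed simp

text \<open>Take a finite union whose measure is within \<epsilon>/2 of the supremum over all finite
  unions. No \<open>E m\<close> can add more than \<epsilon>/2 to it, so each meets it in measure at
  least \<epsilon>/2, and hence meets one of its \<open>card S\<close> members in measure at least
  \<delta> = \<epsilon>/(2 \<open>card S\<close>). By pigeonhole one member serves infinitely many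
  \<open>m\<close>.\<close>

lemma ex_overlapping:
  assumes "infinite N" "\<And>n. n \<in> N \<Longrightarrow> E n \<in> M" "0 < \<epsilon>" "\<And>n. n \<in> N \<Longrightarrow> \<epsilon> \<le> \<mu> (E n)"
  obtains n \<delta> where "n \<in> N" "0 < \<delta>" "infinite {m \<in> N. \<delta> \<le> \<mu> (E n \<inter> E m)}"
proof -
  define V where "V = {\<mu> (\<Union>i\<in>S. E i) | S. finite S \<and> S \<subseteq> N}"
  have bdd: "bdd_above V"
    using assms(2) by (auto simp: V_def intro!: bdd_aboveI[of _ 1] measure_le_1 finite_UN)
  have "\<mu> {} \<in> V" by (auto simp: V_def intro!: exI[of _ "{}"])
  then obtain v where "v \<in> V" "Sup V - \<epsilon> / 2 < v"
    using less_cSupE[of "Sup V - \<epsilon> / 2" V] \<open>0 < \<epsilon>\<close> by auto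
  then obtain S where S: "finite S" "S \<subseteq> N" "Sup V - \<epsilon> / 2 < \<mu> (\<Union>i\<in>S. E i)"
    by (auto simp: V_def)
  have UM: "(\<Union>i\<in>S. E i) \<in> M" using S assms(2) by (intro finite_UN) auto
  have half: "\<epsilon> / 2 \<le> \<mu> (E m \<inter> (\<Union>i\<in>S. E i))" if "m \<in> N" for m
  proof -
    have "\<mu> (\<Union>i\<in>insert m S. E i) \<in> V"
      unfolding V_def using S that by blast
    then have "\<mu> ((\<Union>i\<in>S. E i) \<union> (E m - (\<Union>i\<in>S. E i))) \<le> Sup V"
      using cSup_upper[OF _ bdd] by (simp add: Un_commute)
    moreover have "\<mu> ((\<Union>i\<in>S. E i) \<union> (E m - (\<Union>i\<in>S. E i))) =
        \<mu> (\<Union>i\<in>S. E i) + \<mu> (E m - (\<Union>i\<in>S. E i))"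
      using UM assms(2) that by (intro measure_disjoint_Un) auto
    moreover have "\<mu> (E m) = \<mu> (E m \<inter> (\<Union>i\<in>S. E i)) + \<mu> (E m - (\<Union>i\<in>S. E i))"
      using UM assms(2) that by (intro measure_split) auto
    ultimately show ?thesis using S(3) assms(4)[OF that] by linarith
  qed
  have "S \<noteq> {}"
    using half assms(1,3) by (metis UN_empty finite.emptyI inf_bot_right measure_empty
        half_gt_zero_iff not_le all_not_in_conv)
  then have cS: "card S > 0" using S by (simp add: card_gt_0_iff)
  define \<delta> where "\<delta> = \<epsilon> / 2 / card S"
  have "\<exists>n\<in>S. \<delta> \<le> \<mu> (E n \<inter> E m)" if "m \<in> N" for m
  proof (rule ccontr)
    assume "\<not> ?thesis"
    then have "(\<Sum>n\<in>S. \<mu> (E n \<inter> E m)) < (\<Sum>n\<in>S. \<delta>)"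
      using S \<open>S \<noteq> {}\<close> by (intro sum_strict_mono) auto
    also have "\<dots> = \<epsilon> / 2" using cS by (simp add: \<delta>_def)
    also have "\<dots> \<le> \<mu> (\<Union>n\<in>S. E n \<inter> E m)" using half[OF that] by (simp add: Int_commute)
    also have "\<dots> \<le> (\<Sum>n\<in>S. \<mu> (E n \<inter> E m))"
      using S assms(2) that by (intro measure_UN_le) auto
    finally show False by simp
  qed
  then have "N = (\<Union>n\<in>S. {m \<in> N. \<delta> \<le> \<mu> (E n \<inter> E m)})" by blast
  then obtain n where "n \<in> S" "infinite {m \<in> N. \<delta> \<le> \<mu> (E n \<inter> E m)}"
    using assms(1) S(1) by (metis (no_types, lifting) finite_UN_I)
  moreover have "0 < \<delta>" using cS assms(3) by (simp add: \<delta>_def)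
  ultimately show thesis using that S(2) by blast
qed

text \<open>Iterating the overlap argument inside a shrinking set \<open>W\<close> keeps infinitely
  many \<open>E m\<close> that meet \<open>W\<close> in measure bounded below. The bound may tend to
  0, so only the finite intersections are claimed to be nonempty.\<close>

lemma ex_subsequence_meeting:
  assumes E: "\<And>n. E n \<in> M" and \<epsilon>: "0 < \<epsilon>" "\<And>n. \<epsilon> \<le> \<mu> (E n)"
  obtains s :: "nat \<Rightarrow> nat" where "strict_mono s" "\<And>k. (\<Inter>i\<le>k. E (s i)) \<noteq> {}"
proof -
  \<comment> \<open>A state consists of the last chosen index \<open>n\<close>, a set
    \<open>W\<close> inside the intersection chosen so far, and the infinite set \<open>N\<close> of
    indices that remain usable.\<close>
  define P where "P k u \<longleftrightarrow> (case u of (n, W, N) \<Rightarrow> W \<in> M \<and> W \<subseteq> E n \<and> infinite N \<and>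
      (\<exists>\<delta>>0. \<forall>m\<in>N. \<delta> \<le> \<mu> (W \<inter> E m)))"
    for k :: nat and u :: "nat \<times> 'a set \<times> nat set"
  define Q where "Q k u v \<longleftrightarrow> (case u of (n, W, N) \<Rightarrow> case v of (n', W', N') \<Rightarrow>
      n < n' \<and> W' \<subseteq> W)" for k :: nat and u v :: "nat \<times> 'a set \<times> nat set"
  have step: "\<exists>v. P (Suc k) v \<and> Q k (n, W, N) v"
    if "W \<in> M" "infinite N" "0 < \<delta>" "\<And>m. m \<in> N \<Longrightarrow> \<delta> \<le> \<mu> (W \<inter> E m)" for k n W N \<delta>
  proof -
    note N = that
    have inf: "infinite (N \<inter> {n<..})"
      using that(2) by (metis Diff_eq Compl_greaterThan finite_Diff2 finite_atMost Diff_Compl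
          inf_commute)
    obtain n' \<delta>' where n': "n' \<in> N \<inter> {n<..}" "0 < \<delta>'"
      "infinite {m \<in> N \<inter> {n<..}. \<delta>' \<le> \<mu> (W \<inter> E n' \<inter> (W \<inter> E m))}"
      by (rule ex_overlapping[OF inf, of "\<lambda>m. W \<inter> E m" \<delta>]) (use N E in auto)
    define N' where "N' = {m \<in> N \<inter> {n<..}. \<delta>' \<le> \<mu> (W \<inter> E n' \<inter> (W \<inter> E m))}"
    have eq: "W \<inter> E n' \<inter> (W \<inter> E m) = W \<inter> E n' \<inter> E m" for m by blast
    have "P (Suc k) (n', W \<inter> E n', N')"
      using n' N(1) E by (auto simp: P_def N'_def eq)
    moreover have "Q k (n, W, N) (n', W \<inter> E n', N')"
      using n' by (auto simp: Q_def)
    ultimately show ?thesis by blast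
  qed
  have "\<exists>f. \<forall>k. P k (f k) \<and> Q k (f k) (f (Suc k))"
  proof (rule dependent_nat_choice)
    have "\<Omega> \<inter> E m = E m" for m using sets_into_space[OF E] by blast
    \<comment> \<open>The triple \<open>(0, \<Omega>, UNIV)\<close> need not satisfy
      \<open>P\<close>, which would ask for \<open>\<Omega> \<subseteq> E 0\<close>. It only serves
      to run one step, whose result is the first state.\<close>
    then have "\<exists>v. P (Suc 0) v \<and> Q 0 (0, \<Omega>, UNIV) v"
      using \<epsilon> by (intro step[of \<Omega> UNIV \<epsilon>]) auto
    then show "\<exists>u. P 0 u" by (auto simp: P_def)
  next
    fix u k
    assume "P k u"
    then show "\<exists>v. P (Suc k) v \<and> Q k u v"
      using step by (cases u) (auto simp: P_def)
  qed
  then obtain f where f: "\<And>k. P k (f k)" "\<And>k. Q k (f k) (f (Suc k))" by blast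
  define s W where "s k = fst (f k)" and "W k = fst (snd (f k))" for k
  have P: "W k \<in> M" "W k \<subseteq> E (s k)" "\<exists>m \<delta>. 0 < \<delta> \<and> \<delta> \<le> \<mu> (W k \<inter> E m)" for k
  proof -
    obtain N where N: "f k = (s k, W k, N)" by (metis s_def W_def prod.collapse)
    show "W k \<in> M" "W k \<subseteq> E (s k)" using f(1)[of k] by (auto simp: P_def N)
    have "infinite N" using f(1)[of k] by (simp add: P_def N)
    then obtain m where "m \<in> N" using infinite_imp_nonempty by blast
    then show "\<exists>m \<delta>. 0 < \<delta> \<and> \<delta> \<le> \<mu> (W k \<inter> E m)"
      using f(1)[of k] by (auto simp: P_def N)
  qed
  have Q: "s k < s (Suc k)" "W (Suc k) \<subseteq> W k" for k
    using f(2)[of k] by (auto simp: Q_def s_def W_def split: prod.splits)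
  have anti: "W k \<subseteq> W i" if "i \<le> k" for i k
    using lift_Suc_antimono_le[of W] Q(2) that by blast
  have "(\<Inter>i\<le>k. E (s i)) \<noteq> {}" for k
  proof -
    have "W k \<subseteq> (\<Inter>i\<le>k. E (s i))" using anti P(2) by blast
    moreover have "W k \<noteq> {}" using P(3)[of k] by auto
    ultimately show ?thesis by blast
  qed
  moreover have "strict_mono s" using Q(1) by (simp add: strict_mono_Suc_iff)
  ultimately show thesis using that by blast
qed

text \<open>If no finite set met all \<open>E b\<close>, parameters could be chosen one after
  another so that each \<open>E (b n)\<close> misses the points picked earlier. Along a subsequence
  with nonempty finite intersections, the picked point \<open>a k\<close> lies in the sets with
  index at most \<open>k\<close> and in none of the later ones, which is a half graph.\<close>

lemma ex_finite_transversal: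
  assumes st: "pair_stable \<Omega> T (\<lambda>a b. a \<in> E b)"
    and E: "\<And>b. b \<in> T \<Longrightarrow> E b \<in> M" and \<epsilon>: "0 < \<epsilon>" "\<And>b. b \<in> T \<Longrightarrow> \<epsilon> \<le> \<mu> (E b)"
  obtains F where "finite F" "F \<subseteq> \<Omega>" "\<And>b. b \<in> T \<Longrightarrow> \<exists>a\<in>F. a \<in> E b"
proof (rule ccontr)
  assume "\<not> thesis"
  then have bad: "\<exists>b\<in>T. \<forall>a\<in>F. a \<notin> E b" if "finite F" "F \<subseteq> \<Omega>" for F
    using that \<open>\<And>F. finite F \<Longrightarrow> F \<subseteq> \<Omega> \<Longrightarrow> (\<And>b. b \<in> T \<Longrightarrow> \<exists>a\<in>F. a \<in> E b) \<Longrightarrow> thesis\<close> by meson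
  define pick where "pick S = (SOME a. a \<in> (\<Inter>b\<in>S. E b))" for S
  \<comment> \<open>each \<open>b n\<close> avoids the witnesses of all subfamilies of its predecessors, so that a
    subsequence can be chosen afterwards\<close>
  define P where "P f n b \<longleftrightarrow> b \<in> T \<and> (\<forall>S. S \<subseteq> f ` {..<n} \<and> S \<noteq> {} \<and> (\<Inter>b\<in>S. E b) \<noteq> {} \<longrightarrow> pick S \<notin> E b)"
    for f :: "nat \<Rightarrow> 'b" and n b
  have pick: "pick S \<in> (\<Inter>b\<in>S. E b)" if "(\<Inter>b\<in>S. E b) \<noteq> {}" for S
    using that unfolding pick_def by (metis some_in_eq)
  have "\<exists>f. \<forall>n. P f n (f n)"
  proof (rule dependent_wellorder_choice)
    fix r and f g :: "nat \<Rightarrow> 'b" and n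
    assume "\<And>y. y < n \<Longrightarrow> f y = g y"
    then have "f ` {..<n} = g ` {..<n}" by auto
    then show "P f n r = P g n r" by (simp add: P_def)
  next
    fix n and f :: "nat \<Rightarrow> 'b"
    assume IH: "\<And>m. m < n \<Longrightarrow> P f m (f m)"
    let ?\<S> = "{S. S \<subseteq> f ` {..<n} \<and> S \<noteq> {} \<and> (\<Inter>b\<in>S. E b) \<noteq> {}}"
    have "pick S \<in> \<Omega>" if S: "S \<in> ?\<S>" for S
    proof -
      obtain b where "b \<in> S" using S by blast
      then have "b \<in> T" "pick S \<in> E b" using S IH pick[of S] by (auto simp: P_def)
      then show ?thesis using sets_into_space[OF E] by blast
    qed
    moreover have "finite (pick ` ?\<S>)"
      by (intro finite_imageI finite_subset[of ?\<S> "Pow (f ` {..<n})"]) auto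
    ultimately have "\<exists>b\<in>T. \<forall>a\<in>pick ` ?\<S>. a \<notin> E b" by (intro bad) blast+
    then obtain b where "b \<in> T" "\<forall>a\<in>pick ` ?\<S>. a \<notin> E b" by blast
    then show "\<exists>b. P f n b" by (auto simp: P_def)
  qed
  then obtain b where b: "\<And>n. P b n (b n)" by blast
  have bT: "b n \<in> T" for n using b[of n] by (simp add: P_def)
  obtain s :: "nat \<Rightarrow> nat" where s: "strict_mono s" "\<And>k. (\<Inter>i\<le>k. E (b (s i))) \<noteq> {}"
    by (rule ex_subsequence_meeting[of "\<lambda>n. E (b n)" \<epsilon>]) (use E \<epsilon> bT in auto)
  define S where "S k = (\<lambda>i. b (s i)) ` {..k}" for k :: nat
  define a where "a k = pick (S k)" for k
  have ne: "(\<Inter>b\<in>S k. E b) \<noteq> {}" for k using s(2)[of k] by (simp add: S_def image_comp)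
  have mem: "a k \<in> E (b (s i))" if "i \<le> k" for i k
    using pick[OF ne[of k]] that by (auto simp: S_def a_def)
  have nmem: "a i \<notin> E (b (s j))" if "i < j" for i j
  proof -
    have "S i \<subseteq> b ` {..<s j}"
      using that s(1) by (auto simp: S_def strict_mono_less)
    moreover have "S i \<noteq> {}" by (simp add: S_def)
    ultimately show ?thesis using b[of "s j"] ne[of i] unfolding P_def a_def by blast
  qed
  have "a k \<in> \<Omega>" for k using mem[of k k] sets_into_space[OF E[OF bT]] by blast
  then show False
    using mem nmem bT by (intro pair_stableD[OF st, of a "\<lambda>i. b (s i)" False]) auto
qed

text \<open>The count that ends the argument attaches to each branch \<open>x\<close> a finite set
  \<open>F x\<close> of points and the traces on it of the parameters at which \<open>x\<close>
  takes the positive side. Such codes range over a countable set, and they determine the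
  branch.\<close>

lemma ex_unsplit_set:
  assumes st: "pair_stable \<Omega> T (\<lambda>a b. a \<in> E b)" and E: "\<And>b. b \<in> T \<Longrightarrow> E b \<in> M"
  obtains W where "W \<in> M" "0 < \<mu> W" "\<And>b. b \<in> T \<Longrightarrow> \<mu> (W \<inter> E b) = 0 \<or> \<mu> (W - E b) = 0"
proof (rule ccontr)
  assume contr: "\<not> thesis"
  have "\<exists>b\<in>T. 0 < \<mu> (V \<inter> E b) \<and> 0 < \<mu> (V - E b)" if V: "V \<in> M" "0 < \<mu> V" for V
  proof (rule ccontr)
    assume neg: "\<not> ?thesis"
    have "\<mu> (V \<inter> E b) = 0 \<or> \<mu> (V - E b) = 0" if "b \<in> T" for b
    proof -
      have "\<not> 0 < \<mu> (V \<inter> E b) \<or> \<not> 0 < \<mu> (V - E b)" using neg that by blast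
      moreover have "0 \<le> \<mu> (V \<inter> E b)" "0 \<le> \<mu> (V - E b)"
        using V E[OF that] by (auto intro!: nonneg)
      ultimately show ?thesis by linarith
    qed
    then show False using contr \<open>\<And>W. W \<in> M \<Longrightarrow> 0 < \<mu> W \<Longrightarrow> (\<And>b. b \<in> T \<Longrightarrow> \<mu> (W \<inter> E b) = 0 \<or> \<mu> (W - E b) = 0) \<Longrightarrow> thesis\<close>
      V by meson
  qed
  \<comment> \<open>The splitting parameter is a function of the set \<open>V\<close> alone, so
    branches that agree below level \<open>n\<close> use the same parameter at level
    \<open>n\<close>.\<close>
  then obtain sp where sp: "\<And>V. V \<in> M \<Longrightarrow> 0 < \<mu> V \<Longrightarrow>
      sp V \<in> T \<and> 0 < \<mu> (V \<inter> E (sp V)) \<and> 0 < \<mu> (V - E (sp V))" by metis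
  \<comment> \<open>a full binary tree of sets of positive measure, with a branch for every set of levels\<close>
  define W where "W x n = rec_nat \<Omega> (\<lambda>n V. if n \<in> x then V \<inter> E (sp V) else V - E (sp V)) n"
    for x :: "nat set" and n
  have W0: "W x 0 = \<Omega>" and WSuc: "W x (Suc n) =
      (if n \<in> x then W x n \<inter> E (sp (W x n)) else W x n - E (sp (W x n)))" for x n
    by (simp_all add: W_def)
  have Wpos: "W x n \<in> M \<and> 0 < \<mu> (W x n)" for x n
  proof (induction n)
    case (Suc n)
    then show ?case using sp[of "W x n"] E by (auto simp: WSuc)
  qed (simp add: W0 total)
  have Wsub: "W x n \<subseteq> W x m" if "m \<le> n" for x m n
    using lift_Suc_antimono_le[of "W x"] that by (auto simp: WSuc)
  have Wcong: "W x n = W y n" if "\<And>i. i < n \<Longrightarrow> i \<in> x \<longleftrightarrow> i \<in> y" for x y n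
    using that by (induction n) (auto simp: W0 WSuc)
  have Wfin: "finite (range (\<lambda>x. W x n))" for n
  proof (induction n)
    case (Suc n)
    have "range (\<lambda>x. W x (Suc n)) \<subseteq> (\<lambda>V. V \<inter> E (sp V)) ` range (\<lambda>x. W x n) \<union>
        (\<lambda>V. V - E (sp V)) ` range (\<lambda>x. W x n)"
      by (rule image_subsetI) (simp add: WSuc)
    then show ?case by (rule finite_subset) (intro finite_UnI finite_imageI Suc)
  qed (simp add: W0)
  define b where "b x n = sp (W x n)" for x n
  define a where "a x n = (SOME a. a \<in> W x n)" for x n
  have bT: "b x n \<in> T" for x n using sp Wpos by (simp add: b_def)
  have aW: "a x n \<in> W x n" for x n
  proof -
    have "W x n \<noteq> {}" using Wpos[of x n] by auto
    then show ?thesis unfolding a_def by (simp add: some_in_eq)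
  qed
  have ab: "a x n \<in> E (b x i) \<longleftrightarrow> i \<in> x" if "i < n" for x n i
  proof -
    have "a x n \<in> W x (Suc i)" using aW Wsub[of "Suc i" n x] that by auto
    then show ?thesis by (auto simp: WSuc b_def split: if_splits)
  qed
  \<comment> \<open>Each level of the tree has finitely many nodes, so one chosen point per node
    gives a countable pool \<open>D\<close> shared by all branches.\<close>
  define D where "D = (\<Union>n. (\<lambda>V. SOME a. a \<in> V) ` range (\<lambda>x. W x n))"
  have "countable ((\<lambda>V. SOME a. a \<in> V) ` range (\<lambda>x. W x n))" for n
    by (intro countable_finite finite_imageI Wfin)
  then have "countable D"
    unfolding D_def by (rule countable_UN[OF countableI_type])
  have aD: "a x n \<in> D" for x n by (auto simp: D_def a_def)
  have D\<Omega>: "a x n \<in> \<Omega>" for x n using aW[of x n] Wpos[of x n] sets_into_space by blast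
  define tr where "tr F b = {a \<in> F. a \<in> E b}" for F b
  have "\<exists>F. finite F \<and> F \<subseteq> D \<and> (\<forall>i j. i \<in> x \<longrightarrow> j \<notin> x \<longrightarrow> \<not> tr F (b x i) \<subseteq> tr F (b x j))" for x
  proof -
    have inj: "i \<in> x \<longleftrightarrow> j \<in> x" if "b x i = b x j" for i j
      using ab[of i "Suc (max i j)" x] ab[of j "Suc (max i j)" x] that by auto
    have st': "pair_stable (range (a x)) (range (b x)) (\<lambda>a b. a \<in> E b)"
      using D\<Omega> bT by (intro pair_stable_mono[OF st]) auto
    \<comment> \<open>Along the branch \<open>x\<close>, the point \<open>a x n\<close> follows the
      prescription of \<open>x\<close> at all levels below \<open>n\<close>. The positive parameters
      of \<open>x\<close> are thus finitely approximated by points of that branch, and definability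
      applies.\<close>
    have close: "\<exists>a'\<in>range (a x). \<forall>y\<in>T0. a' \<in> E y \<longleftrightarrow> y \<in> b x ` x"
      if T0: "finite T0" "T0 \<subseteq> range (b x)" for T0
    proof -
      obtain I where I: "finite I" "T0 = b x ` I"
        using finite_subset_image[OF T0] by blast
      obtain n where n: "I \<subseteq> {..<n}"
        using I(1) finite_nat_iff_bounded by blast
      have "\<forall>y\<in>T0. a x n \<in> E y \<longleftrightarrow> y \<in> b x ` x"
      proof
        fix y assume "y \<in> T0"
        then obtain i where i: "i \<in> I" "y = b x i" using I by blast
        then have "a x n \<in> E y \<longleftrightarrow> i \<in> x" using ab n by auto
        then show "a x n \<in> E y \<longleftrightarrow> y \<in> b x ` x" using inj i by blast
      qed
      then show ?thesis by blast
    qed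
    obtain F where F: "finite F" "F \<subseteq> range (a x)"
      "\<And>u v. u \<in> b x ` x \<Longrightarrow> v \<in> range (b x) - b x ` x \<Longrightarrow> \<exists>a'\<in>F. a' \<in> E u \<and> \<not> a' \<in> E v"
      by (rule pair_stable_definable[OF st' image_mono[OF subset_UNIV]], erule (1) close)
        (rule that)
    have "\<not> tr F (b x i) \<subseteq> tr F (b x j)" if "i \<in> x" "j \<notin> x" for i j
    proof -
      have "b x j \<notin> b x ` x" using inj that by blast
      then show ?thesis using F(3)[of "b x i" "b x j"] that by (auto simp: tr_def)
    qed
    then show ?thesis using F aD by (intro exI[of _ F]) auto
  qed
  then obtain F where F: "\<And>x. finite (F x)" "\<And>x. F x \<subseteq> D"
    "\<And>x i j. i \<in> x \<Longrightarrow> j \<notin> x \<Longrightarrow> \<not> tr (F x) (b x i) \<subseteq> tr (F x) (b x j)"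
    by metis
  define \<Phi> where "\<Phi> x = (F x, (\<lambda>i. tr (F x) (b x i)) ` x)" for x
  have "inj \<Phi>"
  proof (rule injI, rule ccontr)
    fix x y assume eq: "\<Phi> x = \<Phi> y" and "x \<noteq> y"
    \<comment> \<open>At the first level \<open>n\<close> where two branches differ they still share
      the parameter. If the codes agree, its trace, positive for one branch, equals the trace of a
      positive parameter of the other branch, for which it is negative; the finite set
      \<open>F\<close> separates the two.\<close>
    then have ex: "\<exists>i. (i \<in> x) \<noteq> (i \<in> y)" by blast
    then obtain n where n: "(n \<in> x) \<noteq> (n \<in> y)" and least: "\<And>i. i < n \<Longrightarrow> (i \<in> x) = (i \<in> y)"
      using iffD1[OF exists_least_iff ex] by blast
    have bn: "b x n = b y n" using Wcong[of n x y] least by (simp add: b_def)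
    have aux: False if xy: "\<Phi> x = \<Phi> y" "n \<in> x" "n \<notin> y" "b x n = b y n" for x y
    proof -
      have Feq: "F x = F y" and "(\<lambda>i. tr (F x) (b x i)) ` x = (\<lambda>i. tr (F y) (b y i)) ` y"
        using that(1) unfolding \<Phi>_def by blast+
      then have "tr (F x) (b x n) \<in> (\<lambda>i. tr (F y) (b y i)) ` y"
        using that(2) by blast
      with Feq obtain i where "i \<in> y" "tr (F y) (b y n) = tr (F y) (b y i)"
        using xy(4) by auto
      then show False using F(3)[of i y n] that(3) by blast
    qed
    show False using aux[of x y] aux[of y x] n bn eq by metis
  qed
  moreover have "countable (range \<Phi>)"
  proof -
    let ?\<F> = "{A. finite A \<and> A \<subseteq> D}"
    have "range \<Phi> \<subseteq> ?\<F> \<times> {A. finite A \<and> A \<subseteq> ?\<F>}"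
    proof
      fix z assume "z \<in> range \<Phi>"
      then obtain x where z: "z = \<Phi> x" by blast
      have "finite ((\<lambda>i. tr (F x) (b x i)) ` x)"
        by (rule finite_subset[of _ "Pow (F x)"]) (use F(1) in \<open>auto simp: tr_def\<close>)
      moreover have "finite (tr (F x) u)" "tr (F x) u \<subseteq> D" for u
        using F(1,2)[of x] by (auto simp: tr_def)
      ultimately show "z \<in> ?\<F> \<times> {A. finite A \<and> A \<subseteq> ?\<F>}"
        using F(1,2)[of x] by (auto simp: z \<Phi>_def)
    qed
    moreover have "countable (?\<F> \<times> {A. finite A \<and> A \<subseteq> ?\<F>})"
      using \<open>countable D\<close> by (intro countable_SIGMA countable_Collect_finite_subset) auto
    ultimately show ?thesis by (rule countable_subset)
  qed
  ultimately have "countable (UNIV :: nat set set)"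
    by (rule countable_image_inj_on[rotated])
  then have "from_nat_into UNIV ` UNIV = Pow (UNIV :: nat set)"
    using range_from_nat_into[of "UNIV :: nat set set"] by simp
  then show False using Cantors_theorem[of "UNIV :: nat set"] by (elim notE) (rule exI)
qed

end

section \<open>Definable sets as members of an algebra\<close>

lemma (in Sigma_Algebra.algebra) sets_Collect_finite_Ball:
  assumes "\<And>i. i \<in> S \<Longrightarrow> {x \<in> \<Omega>. P i x} \<in> M" "finite S"
  shows "{x \<in> \<Omega>. \<forall>i\<in>S. P i x} \<in> M"
  using assms sets_Collect_finite_All'[of S P] by (cases "S = {}") auto

text \<open>Separation by a finite \<open>F\<close> makes \<open>Y\<close> a positive Boolean
  combination of rows: the union, over the traces on \<open>F\<close> of members of
  \<open>Y\<close>, of the intersection of the rows in the trace. There are finitely many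
  traces.\<close>

lemma pair_stable_definable_in_algebra:
  assumes alg: "Sigma_Algebra.algebra T B" and st: "pair_stable D T R"
    and rows: "\<And>a. a \<in> D \<Longrightarrow> {b \<in> T. R a b} \<in> B" and Y: "Y \<subseteq> T"
    and close: "\<And>T0. finite T0 \<Longrightarrow> T0 \<subseteq> T \<Longrightarrow> \<exists>a\<in>D. \<forall>y\<in>T0. R a y \<longleftrightarrow> y \<in> Y"
  shows "Y \<in> B"
proof -
  interpret Sigma_Algebra.algebra T B by (rule alg)
  obtain F where F: "finite F" "F \<subseteq> D"
    and sep: "\<And>b c. b \<in> Y \<Longrightarrow> c \<in> T - Y \<Longrightarrow> \<exists>a\<in>F. R a b \<and> \<not> R a c"
    by (rule pair_stable_definable[OF st Y], erule (1) close) (rule that)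
  define \<S> where "\<S> = (\<lambda>b. {a \<in> F. R a b}) ` Y"
  have fin: "finite \<S>" "S \<in> \<S> \<Longrightarrow> finite S" for S
    using F(1) by (auto simp: \<S>_def intro: finite_subset[of _ "Pow F"])
  have sub: "S \<subseteq> D" if "S \<in> \<S>" for S
    using that F(2) by (auto simp: \<S>_def)
  have "Y = {c \<in> T. \<exists>S\<in>\<S>. \<forall>a\<in>S. R a c}"
  proof (rule equalityI; rule subsetI)
    fix c assume "c \<in> {c \<in> T. \<exists>S\<in>\<S>. \<forall>a\<in>S. R a c}"
    then show "c \<in> Y" using sep by (auto simp: \<S>_def)
  qed (use Y in \<open>auto simp: \<S>_def\<close>)
  also have "\<dots> \<in> B"
    using fin sub rows by (intro sets_Collect_finite_Ex sets_Collect_finite_Ball) auto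
  finally show ?thesis .
qed

section \<open>Equality up to null sets\<close>

context fin_additive_prob
begin

definition aeq :: "'a set \<Rightarrow> 'a set \<Rightarrow> bool" where
  "aeq A B \<longleftrightarrow> \<mu> (sym_diff A B) = 0"

lemma aeq_iff:
  assumes "A \<in> M" "B \<in> M"
  shows "aeq A B \<longleftrightarrow> \<mu> (A - B) = 0 \<and> \<mu> (B - A) = 0"
proof -
  have "\<mu> (sym_diff A B) = \<mu> (A - B) + \<mu> (B - A)"
    using assms by (intro measure_disjoint_Un) auto
  moreover have "0 \<le> \<mu> (A - B)" "0 \<le> \<mu> (B - A)" using assms by (auto intro!: nonneg)
  ultimately show ?thesis by (auto simp: aeq_def)
qed

lemma aeq_refl [simp]: "aeq A A"
  by (simp add: aeq_def)

lemma aeq_sym: "aeq A B \<longleftrightarrow> aeq B A"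
  by (simp add: aeq_def Un_commute)

lemma null_diff_trans:
  assumes "A \<in> M" "B \<in> M" "C \<in> M" "\<mu> (A - B) = 0" "\<mu> (B - C) = 0"
  shows "\<mu> (A - C) = 0"
proof (rule null_subset)
  show "\<mu> ((A - B) \<union> (B - C)) = 0" using assms by (intro null_Un) auto
qed (use assms in auto)

lemma aeq_trans: "\<lbrakk>A \<in> M; B \<in> M; C \<in> M; aeq A B; aeq B C\<rbrakk> \<Longrightarrow> aeq A C"
  using null_diff_trans[of A B C] null_diff_trans[of C B A] by (simp add: aeq_iff)

lemma aeq_measure:
  assumes "A \<in> M" "B \<in> M" "aeq A B"
  shows "\<mu> A = \<mu> B"
  using measure_split[of A B] measure_split[of B A] assms by (simp add: aeq_iff Int_commute)

end

section \<open>Cosets and invariant algebras\<close>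

context group
begin

text \<open>Presenting a translate as a preimage makes its compatibility with Boolean operations
  immediate.\<close>

lemma l_coset_eq:
  assumes "g \<in> carrier G" "A \<subseteq> carrier G"
  shows "g <# A = {x \<in> carrier G. inv g \<otimes> x \<in> A}"
proof (rule equalityI; rule subsetI)
  fix x assume "x \<in> g <# A"
  then show "x \<in> {x \<in> carrier G. inv g \<otimes> x \<in> A}"
    using assms by (auto simp: l_coset_def m_assoc[symmetric] subset_iff)
next
  fix x assume "x \<in> {x \<in> carrier G. inv g \<otimes> x \<in> A}"
  then have "x = g \<otimes> (inv g \<otimes> x)" "inv g \<otimes> x \<in> A"
    using assms by (auto simp: m_assoc[symmetric])
  then show "x \<in> g <# A" unfolding l_coset_def by blast
qed

lemma r_coset_eq:
  assumes "g \<in> carrier G" "A \<subseteq> carrier G"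
  shows "A #> g = {x \<in> carrier G. x \<otimes> inv g \<in> A}"
proof (rule equalityI; rule subsetI)
  fix x assume "x \<in> A #> g"
  then show "x \<in> {x \<in> carrier G. x \<otimes> inv g \<in> A}"
    using assms by (auto simp: r_coset_def m_assoc subset_iff)
next
  fix x assume "x \<in> {x \<in> carrier G. x \<otimes> inv g \<in> A}"
  then have "x = (x \<otimes> inv g) \<otimes> g" "x \<otimes> inv g \<in> A"
    using assms by (auto simp: m_assoc)
  then show "x \<in> A #> g" unfolding r_coset_def by blast
qed

lemma l_coset_Int:
  "\<lbrakk>g \<in> carrier G; A \<subseteq> carrier G; A' \<subseteq> carrier G\<rbrakk> \<Longrightarrow> g <# (A \<inter> A') = (g <# A) \<inter> (g <# A')"
  by (subst (1 2 3) l_coset_eq) auto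

lemma l_coset_Diff:
  "\<lbrakk>g \<in> carrier G; A \<subseteq> carrier G; A' \<subseteq> carrier G\<rbrakk> \<Longrightarrow> g <# (A - A') = (g <# A) - (g <# A')"
  by (subst (1 2 3) l_coset_eq) auto

lemma r_coset_Int:
  "\<lbrakk>g \<in> carrier G; A \<subseteq> carrier G; A' \<subseteq> carrier G\<rbrakk> \<Longrightarrow> (A \<inter> A') #> g = (A #> g) \<inter> (A' #> g)"
  by (subst (1 2 3) r_coset_eq) auto

lemma r_coset_Diff:
  "\<lbrakk>g \<in> carrier G; A \<subseteq> carrier G; A' \<subseteq> carrier G\<rbrakk> \<Longrightarrow> (A - A') #> g = (A #> g) - (A' #> g)"
  by (subst (1 2 3) r_coset_eq) auto

lemma l_coset_eq_iff:
  assumes H: "subgroup H G" and u: "u \<in> carrier G" and v: "v \<in> carrier G"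
  shows "u <# H = v <# H \<longleftrightarrow> inv u \<otimes> v \<in> H"
proof
  interpret subgroup H G by (rule H)
  assume "u <# H = v <# H"
  then have "v \<in> u <# H" using lcos_self[OF v H] by simp
  then show "inv u \<otimes> v \<in> H" using u v subset by (simp add: l_coset_eq)
next
  interpret subgroup H G by (rule H)
  assume "inv u \<otimes> v \<in> H"
  then have "v \<in> u <# H" using u v subset by (simp add: l_coset_eq)
  then show "u <# H = v <# H" using l_repr_independence[OF _ u H] by simp
qed

lemma lcosets_eq_image: "lcosets H = (\<lambda>a. a <# H) ` carrier G"
  by (auto simp: LCOSETS_def)

text \<open>Each fibre of \<open>f\<close> lies in a single left coset, so one representative per
  value of \<open>f\<close> lists all cosets. In the applications \<open>f\<close> is a classifying
  map with visibly finite range.\<close>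

lemma finite_lcosetsI:
  assumes H: "subgroup H G" and fin: "finite (f ` carrier G)"
    and f: "\<And>u v. \<lbrakk>u \<in> carrier G; v \<in> carrier G; f u = f v\<rbrakk> \<Longrightarrow> inv u \<otimes> v \<in> H"
  shows "finite (lcosets H)"
proof -
  define pick where "pick y = (SOME u. u \<in> carrier G \<and> f u = y)" for y
  have "pick (f u) \<in> carrier G \<and> f (pick (f u)) = f u" if "u \<in> carrier G" for u
    unfolding pick_def using that by (rule someI[where x = u, OF conjI]) simp
  then have "u <# H = pick (f u) <# H" if "u \<in> carrier G" for u
    using f that by (metis l_coset_eq_iff[OF H])
  then have "lcosets H \<subseteq> (\<lambda>y. pick y <# H) ` f ` carrier G"
    unfolding lcosets_eq_image image_image by (auto intro!: image_eqI)
  then show ?thesis using fin by (meson finite_imageI finite_subset)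
qed

lemma finite_index_mono:
  assumes "finite (lcosets K)" "subgroup K G" "subgroup H G" "K \<subseteq> H"
  shows "finite_index_subgroup G H"
  unfolding finite_index_subgroup_def
proof
  show "finite (lcosets H)"
    using assms l_coset_eq_iff[OF assms(2)]
    by (intro finite_lcosetsI[of H "\<lambda>u. u <# K"]) (auto simp: lcosets_eq_image)
qed (rule assms)

lemma Union_lcosets_subset:
  assumes K: "subgroup K G" and S: "S \<subseteq> carrier G" and SK: "\<And>s. s \<in> S \<Longrightarrow> s <# K \<subseteq> S"
  shows "S = \<Union>{C \<in> lcosets K. C \<subseteq> S}"
proof
  show "S \<subseteq> \<Union>{C \<in> lcosets K. C \<subseteq> S}"
  proof
    fix s assume s: "s \<in> S"
    then have "s \<in> s <# K" using S K by (intro lcos_self) auto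
    moreover have "s <# K \<in> lcosets K" using s S by (auto simp: lcosets_eq_image)
    ultimately show "s \<in> \<Union>{C \<in> lcosets K. C \<subseteq> S}" using SK[OF s] by blast
  qed
qed auto

end

lemma left_invariant_algebraD:
  assumes "left_invariant_algebra G B"
  shows "Sigma_Algebra.algebra (carrier G) B"
    and "g \<in> carrier G \<Longrightarrow> A \<in> B \<Longrightarrow> g <#\<^bsub>G\<^esub> A \<in> B"
  using assms by (auto simp: left_invariant_algebra_def)

lemma bi_invariant_algebraD:
  assumes "bi_invariant_algebra G B"
  shows "left_invariant_algebra G B" and "g \<in> carrier G \<Longrightarrow> A \<in> B \<Longrightarrow> A #>\<^bsub>G\<^esub> g \<in> B"
  using assms by (auto simp: bi_invariant_algebra_def)

context group
begin

text \<open>The tool for showing that a set belongs to an algebra without describing it: being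
  closed under right multiplication by \<open>K\<close> makes it a finite union of left translates
  of \<open>K\<close>.\<close>

lemma union_of_lcosets_in_algebra:
  assumes B: "left_invariant_algebra G B" and K: "subgroup K G" "finite (lcosets K)" "K \<in> B"
    and S: "S \<subseteq> carrier G" "\<And>s. s \<in> S \<Longrightarrow> s <# K \<subseteq> S"
  shows "S \<in> B"
proof -
  interpret Sigma_Algebra.algebra "carrier G" B by (rule left_invariant_algebraD[OF B])
  have "C \<in> B" if "C \<in> lcosets K" for C
    using that K(3) left_invariant_algebraD(2)[OF B] by (auto simp: lcosets_eq_image)
  then have "\<Union>{C \<in> lcosets K. C \<subseteq> S} \<in> B"
    using K(2) by (intro finite_Union) auto
  then show ?thesis using Union_lcosets_subset[OF K(1) S] by simp
qed

lemma finite_index_subgroup_carrier: "finite_index_subgroup G (carrier G)"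
proof -
  have "a <# carrier G = carrier G" if "a \<in> carrier G" for a
    using that by (auto simp: l_coset_eq)
  then have "lcosets (carrier G) \<subseteq> {carrier G}" by (auto simp: lcosets_eq_image)
  then show ?thesis
    using finite_subset by (auto simp: finite_index_subgroup_def subgroup_self)
qed

text \<open>Every finite-index subgroup in \<open>B\<close> contains the component and is therefore
  a union of its cosets. Finitely many cosets leave finitely many such subgroups, so the component
  is a finite intersection of members of \<open>B\<close>.\<close>

lemma finite_index_component:
  assumes B: "left_invariant_algebra G B" and fin: "finite (lcosets (component G B))"
  shows "finite_index_subgroup G (component G B)" "component G B \<in> B"
proof -
  interpret Sigma_Algebra.algebra "carrier G" B by (rule left_invariant_algebraD[OF B])
  let ?\<H> = "{H. finite_index_subgroup G H \<and> H \<in> B}"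
  have ne: "?\<H> \<noteq> {}" using finite_index_subgroup_carrier top by blast
  have sg: "subgroup (component G B) G"
    unfolding component_def using ne
    by (intro subgroups_Inter) (auto simp: finite_index_subgroup_def)
  then show "finite_index_subgroup G (component G B)"
    using fin by (simp add: finite_index_subgroup_def)
  have "?\<H> \<subseteq> Union ` Pow (lcosets (component G B))"
  proof
    fix H assume H: "H \<in> ?\<H>"
    then interpret subgroup H G by (simp add: finite_index_subgroup_def)
    have "component G B \<subseteq> H" using H by (auto simp: component_def)
    then have "s <# component G B \<subseteq> H" if "s \<in> H" for s
      using that by (auto simp: l_coset_def)
    then have "H = \<Union>{C \<in> lcosets (component G B). C \<subseteq> H}"
      using sg subset by (intro Union_lcosets_subset)
    then show "H \<in> Union ` Pow (lcosets (component G B))" by blast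
  qed
  then have "finite ?\<H>" using fin by (meson finite_Pow_iff finite_imageI finite_subset)
  then have "(\<Inter>H\<in>?\<H>. H) \<in> B" using ne by (intro finite_INT) auto
  then show "component G B \<in> B" by (simp add: component_def)
qed

lemma bi_invariant_algebra_stable_sets: "bi_invariant_algebra G (stable_sets G)"
  unfolding bi_invariant_algebra_def left_invariant_algebra_def algebra_iff_Int
proof (intro conjI ballI)
  note iff = stable_sets_def stable_in_iff_pair_stable
  show "stable_sets G \<subseteq> Pow (carrier G)" by (auto simp: stable_sets_def)
  \<comment> \<open>For a constant relation the indices 0 and 1 already force \<open>c\<close> and
    its negation to agree.\<close>
  have "pair_stable (carrier G) (carrier G) (\<lambda>_ _. False)"
    unfolding pair_stable_def by (auto intro: exI[of _ 0] exI[of _ 1])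
  then show "{} \<in> stable_sets G" by (simp add: iff)
  show "carrier G - A \<in> stable_sets G" if "A \<in> stable_sets G" for A
  proof -
    have "pair_stable (carrier G) (carrier G) (\<lambda>x y. \<not> x \<otimes> y \<in> A)"
      using that by (intro pair_stable_not) (simp add: iff)
    then show ?thesis
      by (auto simp: iff cong: pair_stable_cong)
  qed
  show "A \<inter> A' \<in> stable_sets G" if "A \<in> stable_sets G" "A' \<in> stable_sets G" for A A'
    using that pair_stable_conj[of "carrier G" "carrier G" "\<lambda>x y. x \<otimes> y \<in> A" "\<lambda>x y. x \<otimes> y \<in> A'"]
    by (auto simp: iff)
  fix g A
  assume g: "g \<in> carrier G" and A: "A \<in> stable_sets G"
  then have sub: "A \<subseteq> carrier G" and st: "pair_stable (carrier G) (carrier G) (\<lambda>x y. x \<otimes> y \<in> A)"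
    by (simp_all add: iff)
  have "pair_stable (carrier G) (carrier G) (\<lambda>x y. (inv g \<otimes> x) \<otimes> y \<in> A)"
    using g by (intro pair_stable_image[OF st, where g = "\<lambda>y. y"]) auto
  then show "g <# A \<in> stable_sets G"
    using g sub by (auto simp: iff l_coset_eq m_assoc cong: pair_stable_cong)
  have "pair_stable (carrier G) (carrier G) (\<lambda>x y. x \<otimes> (y \<otimes> inv g) \<in> A)"
    using g by (intro pair_stable_image[OF st, where f = "\<lambda>x. x"]) auto
  then show "A #> g \<in> stable_sets G"
    using g sub by (auto simp: iff r_coset_eq m_assoc cong: pair_stable_cong)
qed

end

section \<open>Invariant measures on stable sets\<close>

locale stable_prob = group G for G (structure) +
  fixes \<mu> :: "'a set \<Rightarrow> real"
  assumes prob: "bi_invariant_probability G \<mu>"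
begin

abbreviation "M \<equiv> stable_sets G"

sublocale fin_additive_prob "carrier G" "stable_sets G" \<mu>
proof -
  have "Sigma_Algebra.algebra (carrier G) (stable_sets G)"
    using bi_invariant_algebra_stable_sets by (intro left_invariant_algebraD bi_invariant_algebraD)
  then show "fin_additive_prob (carrier G) (stable_sets G) \<mu>"
    using prob by (simp add: fin_additive_prob_def fin_additive_prob_axioms_def
        bi_invariant_probability_def)
qed

lemma stable_carrier: "A \<in> M \<Longrightarrow> A \<subseteq> carrier G"
  by (simp add: stable_sets_def)

lemma stable_l_coset [simp]: "g \<in> carrier G \<Longrightarrow> A \<in> M \<Longrightarrow> g <# A \<in> M"
  using left_invariant_algebraD(2)[OF bi_invariant_algebraD(1)[OF bi_invariant_algebra_stable_sets]] .

lemma stable_r_coset [simp]: "g \<in> carrier G \<Longrightarrow> A \<in> M \<Longrightarrow> A #> g \<in> M"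
  using bi_invariant_algebraD(2)[OF bi_invariant_algebra_stable_sets] .

lemma measure_l_coset [simp]: "g \<in> carrier G \<Longrightarrow> A \<in> M \<Longrightarrow> \<mu> (g <# A) = \<mu> A"
  and measure_r_coset [simp]: "g \<in> carrier G \<Longrightarrow> A \<in> M \<Longrightarrow> \<mu> (A #> g) = \<mu> A"
  using prob by (auto simp: bi_invariant_probability_def)

section \<open>Positive measure and genericity on both sides\<close>

lemma pair_stableI: "X \<in> M \<Longrightarrow> pair_stable (carrier G) (carrier G) (\<lambda>a b. a \<otimes> b \<in> X)"
  by (simp add: stable_sets_def stable_in_iff_pair_stable)

text \<open>A finite cover by left translates gives 1 \<le> \<open>card F * \<mu> X\<close>.
  Conversely the sets \<open>{a. a \<otimes> b \<in> X}\<close> are right translates of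
  \<open>X\<close>, all of the same measure; a finite transversal \<open>F\<close> for them says
  that the left translates of \<open>X\<close> by inverses of \<open>F\<close> cover the
  group.\<close>

lemma generic_in_iff_measure_pos:
  assumes X: "X \<in> M"
  shows "generic_in G X \<longleftrightarrow> 0 < \<mu> X"
proof
  assume "generic_in G X"
  then obtain F where F: "finite F" "F \<subseteq> carrier G" "carrier G = F <#> X"
    by (auto simp: generic_in_def)
  have "F <#> X = (\<Union>f\<in>F. f <# X)" by (auto simp: set_mult_def l_coset_def)
  moreover have "f <# X \<in> M" if "f \<in> F" for f using that F(2) X by auto
  ultimately have "\<mu> (F <#> X) \<le> (\<Sum>f\<in>F. \<mu> (f <# X))"
    using measure_UN_le[of F "\<lambda>f. f <# X"] F(1) by simp
  then have "1 \<le> (\<Sum>f\<in>F. \<mu> (f <# X))" using total F(3) by simp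
  also have "\<dots> = card F * \<mu> X" using F X by (simp add: subset_iff)
  finally show "0 < \<mu> X" using nonneg[OF X] by (cases "\<mu> X = 0") auto
next
  assume pos: "0 < \<mu> X"
  have E: "X #> inv b = {a \<in> carrier G. a \<otimes> b \<in> X}" if "b \<in> carrier G" for b
    using that stable_carrier[OF X] by (simp add: r_coset_eq)
  have "pair_stable (carrier G) (carrier G) (\<lambda>a b. a \<in> X #> inv b)"
    using pair_stableI[OF X] E by (auto cong: pair_stable_cong)
  then obtain F where F: "finite F" "F \<subseteq> carrier G"
    "\<And>b. b \<in> carrier G \<Longrightarrow> \<exists>a\<in>F. a \<in> X #> inv b"
    using ex_finite_transversal[of "carrier G" "\<lambda>b. X #> inv b" "\<mu> X"] pos X by auto
  have "carrier G \<subseteq> (\<lambda>a. inv a) ` F <#> X"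
  proof
    fix b assume b: "b \<in> carrier G"
    then obtain a where a: "a \<in> F" "a \<otimes> b \<in> X" using F(3) E by blast
    then have "b = inv a \<otimes> (a \<otimes> b)" using b F(2) by (auto simp: m_assoc[symmetric] subset_iff)
    then show "b \<in> (\<lambda>a. inv a) ` F <#> X" using a by (auto simp: set_mult_def)
  qed
  moreover have "(\<lambda>a. inv a) ` F <#> X \<subseteq> carrier G"
    using F(2) stable_carrier[OF X] by (auto simp: set_mult_def subset_iff)
  ultimately show "generic_in G X"
    unfolding generic_in_def using F by (intro exI[of _ "(\<lambda>a. inv a) ` F"]) auto
qed

text \<open>The mirror image, with the roles of points and parameters exchanged and left invariance
  in place of right invariance: the right translates of \<open>X\<close> by the inverses of
  \<open>F\<close> cover the group.\<close>

lemma ex_right_translates_cover: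
  assumes X: "X \<in> M" and pos: "0 < \<mu> X"
  obtains F where "finite F" "F \<subseteq> carrier G" "\<And>a. a \<in> carrier G \<Longrightarrow> \<exists>b\<in>F. a \<otimes> b \<in> X"
proof -
  have E: "inv a <# X = {b \<in> carrier G. a \<otimes> b \<in> X}" if "a \<in> carrier G" for a
    using that stable_carrier[OF X] by (simp add: l_coset_eq)
  have "pair_stable (carrier G) (carrier G) (\<lambda>b a. b \<in> inv a <# X)"
    using pair_stable_swap[OF pair_stableI[OF X]] E by (auto cong: pair_stable_cong)
  then obtain F where F: "finite F" "F \<subseteq> carrier G"
    "\<And>a. a \<in> carrier G \<Longrightarrow> \<exists>b\<in>F. b \<in> inv a <# X"
    using ex_finite_transversal[of "carrier G" "\<lambda>a. inv a <# X" "\<mu> X"] pos X by auto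
  show thesis
  proof (rule that[OF F(1,2)])
    fix a assume "a \<in> carrier G"
    then show "\<exists>b\<in>F. a \<otimes> b \<in> X" using F(3) E by blast
  qed
qed


lemma aeq_l_coset:
  assumes "g \<in> carrier G" "A \<in> M" "A' \<in> M" "aeq A A'"
  shows "aeq (g <# A) (g <# A')"
proof -
  have "(g <# A) - (g <# A') = g <# (A - A')" "(g <# A') - (g <# A) = g <# (A' - A)"
    using assms by (simp_all add: l_coset_Diff stable_carrier)
  then show ?thesis using assms by (simp add: aeq_iff Diff)
qed

lemma aeq_r_coset:
  assumes "g \<in> carrier G" "A \<in> M" "A' \<in> M" "aeq A A'"
  shows "aeq (A #> g) (A' #> g)"
proof -
  have "(A #> g) - (A' #> g) = (A - A') #> g" "(A' #> g) - (A #> g) = (A' - A) #> g"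
    using assms by (simp_all add: r_coset_Diff stable_carrier)
  then show ?thesis using assms by (simp add: aeq_iff Diff)
qed

section \<open>Stabilisers modulo null sets\<close>

lemma measure_stab_eq: "measure_stab G \<mu> X = {g \<in> carrier G. aeq (g <# X) X}"
  by (simp add: measure_stab_def aeq_def)

lemma subgroup_measure_stab:
  assumes X: "X \<in> M"
  shows "subgroup (measure_stab G \<mu> X) G"
proof (rule subgroupI)
  have "\<one> \<in> measure_stab G \<mu> X"
    using stable_carrier[OF X] by (simp add: measure_stab_eq lcos_mult_one)
  then show "measure_stab G \<mu> X \<noteq> {}" by blast
next
  fix a assume a: "a \<in> measure_stab G \<mu> X"
  then have "aeq (inv a <# (a <# X)) (inv a <# X)"
    using X by (intro aeq_l_coset) (auto simp: measure_stab_eq)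
  moreover have "inv a <# (a <# X) = X"
    using a stable_carrier[OF X] by (simp add: measure_stab_eq lcos_m_assoc lcos_mult_one)
  ultimately show "inv a \<in> measure_stab G \<mu> X"
    using a by (simp add: measure_stab_eq aeq_sym)
next
  fix a b assume a: "a \<in> measure_stab G \<mu> X" and b: "b \<in> measure_stab G \<mu> X"
  have "aeq (a <# (b <# X)) (a <# X)"
    using a b X by (intro aeq_l_coset) (auto simp: measure_stab_eq)
  then have "aeq (a <# (b <# X)) X"
    using a b X by (intro aeq_trans[of "a <# (b <# X)" "a <# X" X]) (auto simp: measure_stab_eq)
  then show "a \<otimes> b \<in> measure_stab G \<mu> X"
    using a b stable_carrier[OF X] by (simp add: measure_stab_eq lcos_m_assoc)
qed (auto simp: measure_stab_eq)

text \<open>The counterpart of \<open>measure_stab\<close> on the other side. Membership of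
  \<open>b\<close> is governed by the sets \<open>{b. a \<otimes> b \<in> X}\<close>, which are left
  translates of \<open>X\<close>; hence this stabiliser, unlike \<open>measure_stab\<close>, can be
  located in a left-invariant algebra.\<close>

definition right_stab :: "'a set \<Rightarrow> 'a set" where
  "right_stab X = {h \<in> carrier G. aeq (X #> h) X}"

lemma aeq_r_cosets_iff:
  assumes X: "X \<in> M" and u: "u \<in> carrier G" and v: "v \<in> carrier G"
  shows "aeq (X #> u) (X #> v) \<longleftrightarrow> u \<otimes> inv v \<in> right_stab X"
proof -
  have "X #> u #> inv v = X #> (u \<otimes> inv v)" "X #> v #> inv v = X"
    "X #> (u \<otimes> inv v) #> v = X #> u"
    using stable_carrier[OF X] u v by (simp_all add: coset_mult_assoc m_assoc)
  then show ?thesis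
    using aeq_r_coset[of "inv v" "X #> u" "X #> v"] aeq_r_coset[of v "X #> (u \<otimes> inv v)" X] X u v
    by (auto simp: right_stab_def)
qed

lemma subgroup_right_stab:
  assumes X: "X \<in> M"
  shows "subgroup (right_stab X) G"
proof (rule subgroupI)
  have "\<one> \<in> right_stab X"
    using stable_carrier[OF X] by (simp add: right_stab_def)
  then show "right_stab X \<noteq> {}" by blast
next
  fix a assume a: "a \<in> right_stab X"
  then have "aeq (X #> \<one>) (X #> a)"
    using stable_carrier[OF X] by (simp add: right_stab_def aeq_sym)
  then show "inv a \<in> right_stab X"
    using aeq_r_cosets_iff[OF X, of \<one> a] a by (simp add: right_stab_def)
next
  fix a b assume a: "a \<in> right_stab X" and b: "b \<in> right_stab X"
  have "aeq (X #> a #> b) (X #> b)"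
    using a b X by (intro aeq_r_coset) (auto simp: right_stab_def)
  then have "aeq (X #> a #> b) X"
    using a b X by (intro aeq_trans[of "X #> a #> b" "X #> b" X]) (auto simp: right_stab_def)
  then show "a \<otimes> b \<in> right_stab X"
    using a b stable_carrier[OF X] by (simp add: right_stab_def coset_mult_assoc)
qed (auto simp: right_stab_def)

text \<open>
  If right translates of an unsplit set \<open>W\<close> cover \<open>G\<close>, each \<open>X b\<^sup>-\<^sup>1\<close> is determined up to a null set
  by the translates of \<open>W\<close> that it contains.
\<close>

lemma right_stab_finite_index:
  assumes B: "left_invariant_algebra G B" and B_stableD: "B \<subseteq> M" and XB: "X \<in> B"
  shows "finite_index_subgroup G (right_stab X)" "right_stab X \<in> B"
proof -
  interpret B: Sigma_Algebra.algebra "carrier G" B by (rule left_invariant_algebraD[OF B])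
  have X: "X \<in> M" using B_stableD XB by blast
  \<comment> \<open>The inverse makes \<open>a \<in> E b\<close> mean
    \<open>a \<otimes> b \<in> X\<close>, so that \<open>E b\<close> is the fibre of the stable
    relation at \<open>b\<close>.\<close>
  define E where "E b = X #> inv b" for b
  have E: "E b \<in> M" if "b \<in> carrier G" for b using that X by (simp add: E_def)
  have mem_E: "a \<in> E b \<longleftrightarrow> a \<otimes> b \<in> X" if "a \<in> carrier G" "b \<in> carrier G" for a b
    using that stable_carrier[OF X] by (simp add: E_def r_coset_eq)
  have "pair_stable (carrier G) (carrier G) (\<lambda>a b. a \<in> E b)"
    using pair_stableI[OF X] mem_E by (simp cong: pair_stable_cong)
  then obtain W where W: "W \<in> M" "0 < \<mu> W"
    and unsplit: "\<And>b. b \<in> carrier G \<Longrightarrow> \<mu> (W \<inter> E b) = 0 \<or> \<mu> (W - E b) = 0"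
    using ex_unsplit_set[of "carrier G" E] E by blast
  obtain F where F: "finite F" "F \<subseteq> carrier G"
    and cover: "\<And>a. a \<in> carrier G \<Longrightarrow> \<exists>f\<in>F. a \<otimes> f \<in> W"
    using ex_right_translates_cover[OF W] by metis
  define V where "V f = W #> inv f" for f
  have V: "V f \<in> M" "\<mu> (V f) = \<mu> W" if "f \<in> F" for f
    using that F(2) W by (auto simp: V_def)
  have V_cover: "\<exists>f\<in>F. a \<in> V f" if "a \<in> carrier G" for a
    using cover[OF that] that F(2) stable_carrier[OF W(1)] by (auto simp: V_def r_coset_eq subset_iff)
  \<comment> \<open>A right translate of an unsplit set is unsplit, because right translation
    permutes the family of all \<open>E b\<close>.\<close>
  have V_unsplit: "\<mu> (V f \<inter> E b) = 0 \<or> \<mu> (V f - E b) = 0" if "f \<in> F" "b \<in> carrier G" for f b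
  proof -
    have f: "f \<in> carrier G" using that F(2) by blast
    have "E b = E (inv f \<otimes> b) #> inv f"
      using f that(2) stable_carrier[OF X]
      by (simp add: E_def coset_mult_assoc inv_mult_group m_assoc)
    then have "V f \<inter> E b = (W \<inter> E (inv f \<otimes> b)) #> inv f" "V f - E b = (W - E (inv f \<otimes> b)) #> inv f"
      using f that(2) E W(1) by (simp_all add: V_def r_coset_Int r_coset_Diff stable_carrier)
    then show ?thesis
      using unsplit[of "inv f \<otimes> b"] f that(2) E W(1) by (simp add: Int Diff)
  qed
  \<comment> \<open>Each \<open>V f\<close> behaves like a complete type for the sets
    \<open>E b\<close>, and \<open>P f\<close> is its defining predicate on parameters.\<close>
  define P where "P f b \<longleftrightarrow> \<mu> (V f - E b) = 0" for f b
  have P_aeq: "(\<forall>f\<in>F. P f b = P f c) \<longleftrightarrow> aeq (E b) (E c)"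
    if b: "b \<in> carrier G" and c: "c \<in> carrier G" for b c
  proof
    have null: "\<mu> (E b - E c) = 0"
      if eq: "\<forall>f\<in>F. P f b = P f c" and b: "b \<in> carrier G" and c: "c \<in> carrier G" for b c
    proof (rule null_subset)
      show "E b - E c \<subseteq> (\<Union>f\<in>F. V f \<inter> (E b - E c))"
        using V_cover stable_carrier[OF E[OF b]] by blast
      show "\<mu> (\<Union>f\<in>F. V f \<inter> (E b - E c)) = 0"
      proof (rule null_UN[OF F(1)])
        fix f assume f: "f \<in> F"
        show "V f \<inter> (E b - E c) \<in> M" by (intro Int Diff V f E b c)
        show "\<mu> (V f \<inter> (E b - E c)) = 0"
        proof (cases "P f b")
          case True
          then have "\<mu> (V f - E c) = 0" using eq f by (simp add: P_def)
          then show ?thesis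
            by (intro null_subset[of "V f \<inter> (E b - E c)" "V f - E c"] Int Diff V f E b c) blast+
        next
          case False
          then have "\<mu> (V f \<inter> E b) = 0" using V_unsplit[OF f b] by (simp add: P_def)
          then show ?thesis
            by (intro null_subset[of "V f \<inter> (E b - E c)" "V f \<inter> E b"] Int Diff V f E b c) blast+
        qed
      qed
      show "E b - E c \<in> M" "(\<Union>f\<in>F. V f \<inter> (E b - E c)) \<in> M"
        by (intro Int Diff finite_UN V E b c F; assumption)+
    qed
    show "aeq (E b) (E c)" if "\<forall>f\<in>F. P f b = P f c"
      using null[of b c] null[of c b] that b c E by (simp add: aeq_iff)
    have P_mono: "P f c" if "P f b" "aeq (E b) (E c)" "f \<in> F" "b \<in> carrier G" "c \<in> carrier G" for f b c
      using that null_diff_trans[of "V f" "E b" "E c"] V E by (simp add: P_def aeq_iff)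
    show "\<forall>f\<in>F. P f b = P f c" if "aeq (E b) (E c)"
      using P_mono[of _ b c] P_mono[of _ c b] that b c aeq_sym by blast
  qed
  \<comment> \<open>The pattern \<open>g b\<close> is a subset of \<open>F\<close>, so the number of
    patterns is finite. Two parameters have the same pattern exactly when they lie in the same left
    coset of \<open>right_stab X\<close>.\<close>
  define g where "g b = {f \<in> F. P f b}" for b
  have g_iff: "g b = g c \<longleftrightarrow> inv b \<otimes> c \<in> right_stab X"
    if b: "b \<in> carrier G" and c: "c \<in> carrier G" for b c
  proof -
    have "g b = g c \<longleftrightarrow> (\<forall>f\<in>F. P f b = P f c)" by (auto simp: g_def)
    also have "\<dots> \<longleftrightarrow> aeq (X #> inv b) (X #> inv c)" using P_aeq[OF b c] by (simp add: E_def)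
    also have "\<dots> \<longleftrightarrow> inv b \<otimes> c \<in> right_stab X"
      using aeq_r_cosets_iff[OF X, of "inv b" "inv c"] b c by simp
    finally show ?thesis .
  qed
  have "finite (g ` carrier G)"
    using F(1) by (intro finite_subset[of "g ` carrier G" "Pow F"]) (auto simp: g_def)
  then have "finite (lcosets (right_stab X))"
    by (rule finite_lcosetsI[OF subgroup_right_stab[OF X]]) (simp add: g_iff)
  then show "finite_index_subgroup G (right_stab X)"
    using subgroup_right_stab[OF X] by (simp add: finite_index_subgroup_def)
  have PB: "{b \<in> carrier G. P f b} \<in> B" if f: "f \<in> F" for f
  proof (rule pair_stable_definable_in_algebra[OF B.algebra_axioms pair_stableI[OF X]])
    fix a assume a: "a \<in> carrier G"
    have "{b \<in> carrier G. a \<otimes> b \<in> X} = inv a <# X"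
      using a stable_carrier[OF X] by (simp add: l_coset_eq)
    then show "{b \<in> carrier G. a \<otimes> b \<in> X} \<in> B"
      using a XB left_invariant_algebraD(2)[OF B] by simp
  next
    fix T0 assume T0: "finite T0" "T0 \<subseteq> carrier G"
    \<comment> \<open>\<open>N y\<close> is the null part of \<open>V f\<close>, on which membership
      in \<open>E y\<close> disagrees with \<open>P f y\<close>. A point of \<open>V f\<close>
      outside finitely many \<open>N y\<close> realises the prescribed pattern, since
      \<open>V f\<close> has positive measure.\<close>
    define N where "N y = (if P f y then V f - E y else V f \<inter> E y)" for y
    have N: "N y \<in> M" "\<mu> (N y) = 0" if "y \<in> T0" for y
    proof -
      have y: "y \<in> carrier G" using that T0 by blast
      then show "N y \<in> M" using f V E by (auto simp: N_def)
      show "\<mu> (N y) = 0" using V_unsplit[OF f y] by (auto simp: N_def P_def)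
    qed
    have "\<mu> (\<Union>y\<in>T0. N y) = 0" using N by (intro null_UN T0) auto
    moreover have "(\<Union>y\<in>T0. N y) \<in> M" using N T0(1) by (intro finite_UN) auto
    ultimately have "\<not> V f \<subseteq> (\<Union>y\<in>T0. N y)"
      using null_subset[of "V f" "\<Union>y\<in>T0. N y"] V[OF f] W(2) by auto
    then obtain a where a: "a \<in> V f" "\<And>y. y \<in> T0 \<Longrightarrow> a \<notin> N y" by blast
    have aG: "a \<in> carrier G" using a(1) stable_carrier V(1)[OF f] by blast
    have "a \<otimes> y \<in> X \<longleftrightarrow> y \<in> {b \<in> carrier G. P f b}" if "y \<in> T0" for y
      using a(1) a(2)[OF that] mem_E[OF aG, of y] that T0(2) by (auto simp: N_def split: if_splits)
    then show "\<exists>a\<in>carrier G. \<forall>y\<in>T0. a \<otimes> y \<in> X \<longleftrightarrow> y \<in> {b \<in> carrier G. P f b}"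
      using aG by blast
  qed simp
  have "{b \<in> carrier G. P f b = P f \<one>} \<in> B" if "f \<in> F" for f
    using PB[OF that] B.sets_Collect_neg[of "P f"] by (cases "P f \<one>") simp_all
  then have "{b \<in> carrier G. \<forall>f\<in>F. P f b = P f \<one>} \<in> B"
    using F(1) by (intro B.sets_Collect_finite_Ball)
  \<comment> \<open>The stabiliser is the set of parameters whose pattern is that of the
    identity.\<close>
  moreover have "right_stab X = {b \<in> carrier G. \<forall>f\<in>F. P f b = P f \<one>}"
  proof -
    have "b \<in> right_stab X \<longleftrightarrow> (\<forall>f\<in>F. P f b = P f \<one>)" if b: "b \<in> carrier G" for b
      using aeq_r_cosets_iff[OF X, of \<one> "inv b"] P_aeq[OF b one_closed] b stable_carrier[OF X]
      by (simp add: E_def aeq_sym)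
    then show ?thesis by (auto simp: right_stab_def)
  qed
  ultimately show "right_stab X \<in> B" by simp
qed

text \<open>Suppose \<open>C \<inter> X\<close> has positive measure. Then every
  \<open>u \<in> C - X\<close> can be moved into \<open>C \<inter> X\<close> by right multiplication
  with some \<open>f\<close> from a finite set. Both \<open>u\<close> and
  \<open>u \<otimes> f\<close> lie in the left coset \<open>C\<close>, so \<open>f \<in> K\<close>,
  and \<open>u\<close> lies in \<open>(X #> inv f) - X\<close>, which is null because
  \<open>K\<close> stabilises \<open>X\<close> on the right. Thus finitely many null sets cover
  \<open>C - X\<close>.\<close>

lemma lcoset_unsplit:
  assumes K: "subgroup K G" "K \<in> M" and X: "X \<in> M" and KX: "K \<subseteq> right_stab X" and C: "C \<in> lcosets K"
  shows "\<mu> (C \<inter> X) = 0 \<or> \<mu> (C - X) = 0"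
proof (cases "\<mu> (C \<inter> X) = 0")
  case False
  interpret K: subgroup K G by (rule K)
  obtain c where c: "c \<in> carrier G" "C = c <# K" using C by (auto simp: lcosets_eq_image)
  have CM: "C \<in> M" using c K(2) by simp
  then have "0 < \<mu> (C \<inter> X)" using False nonneg[of "C \<inter> X"] X by (auto simp: less_le Int)
  then obtain F where F: "finite F" "F \<subseteq> carrier G"
    and cover: "\<And>a. a \<in> carrier G \<Longrightarrow> \<exists>b\<in>F. a \<otimes> b \<in> C \<inter> X"
    using ex_right_translates_cover[of "C \<inter> X"] CM X by (metis Int)
  have "C - X \<subseteq> (\<Union>f\<in>F \<inter> K. (X #> inv f) - X)"
  proof
    fix u assume u: "u \<in> C - X"
    then have uG: "u \<in> carrier G" using stable_carrier[OF CM] by blast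
    obtain f where f: "f \<in> F" "u \<otimes> f \<in> C \<inter> X" using cover[OF uG] by blast
    have fG: "f \<in> carrier G" using f F by blast
    have "inv c \<otimes> u \<in> K" "inv c \<otimes> (u \<otimes> f) \<in> K"
      using u f c uG fG K.subset by (auto simp: l_coset_eq)
    then have "inv (inv c \<otimes> u) \<otimes> (inv c \<otimes> (u \<otimes> f)) \<in> K" by simp
    moreover have "inv (inv c \<otimes> u) \<otimes> (inv c \<otimes> (u \<otimes> f)) = f"
      using c(1) uG fG inv_solve_left'[of f "inv c \<otimes> u" "inv c \<otimes> (u \<otimes> f)"]
      by (simp add: m_assoc)
    ultimately have "f \<in> K" by simp
    moreover have "u \<in> X #> inv f" using f uG fG stable_carrier[OF X] by (simp add: r_coset_eq)
    ultimately show "u \<in> (\<Union>f\<in>F \<inter> K. (X #> inv f) - X)" using f(1) u by blast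
  qed
  moreover have "\<mu> (\<Union>f\<in>F \<inter> K. (X #> inv f) - X) = 0"
  proof (rule null_UN)
    fix f assume "f \<in> F \<inter> K"
    then have f: "f \<in> carrier G" "inv f \<in> right_stab X" using F KX by auto
    then show "(X #> inv f) - X \<in> M" using X by auto
    show "\<mu> ((X #> inv f) - X) = 0" using f X by (simp add: right_stab_def aeq_iff)
  qed (use F in simp)
  moreover have "(\<Union>f\<in>F \<inter> K. (X #> inv f) - X) \<in> M"
    using F X by (intro finite_UN) auto
  ultimately show ?thesis using CM X by (intro disjI2 null_subset[of "C - X"]) auto
qed simp

end

section \<open>Conjugates, normal cores and bi-invariant hulls\<close>

context group
begin

lemma conjugate_eq:
  assumes "a \<in> carrier G" "H \<subseteq> carrier G"
  shows "conjugate G a H = {x \<in> carrier G. inv a \<otimes> x \<otimes> a \<in> H}"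
  unfolding conjugate_def using assms
  by (subst r_coset_eq) (auto simp: l_coset_eq l_coset_subset_G m_assoc)

text \<open>Conjugates are handled as point stabilisers of the left action on
  \<open>lcosets H\<close>, since generic types carry the same action.\<close>

lemma conjugate_eq_stabilizer:
  assumes H: "subgroup H G" and a: "a \<in> carrier G"
  shows "conjugate G a H = {x \<in> carrier G. x <# (a <# H) = a <# H}"
proof -
  interpret subgroup H G by (rule H)
  have "inv a \<otimes> x \<otimes> a \<in> H \<longleftrightarrow> x <# (a <# H) = a <# H" if x: "x \<in> carrier G" for x
    using l_coset_eq_iff[OF H a, of "x \<otimes> a"] a x subset by (auto simp: lcos_m_assoc m_assoc)
  then show ?thesis using a subset by (auto simp: conjugate_eq)
qed

lemma subgroup_conjugate:
  assumes H: "subgroup H G" and a: "a \<in> carrier G"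
  shows "subgroup (conjugate G a H) G"
proof -
  interpret subgroup H G by (rule H)
  let ?S = "{x \<in> carrier G. x <# (a <# H) = a <# H}"
  have sub: "a <# H \<subseteq> carrier G" using a subset by (rule l_coset_subset_G[rotated])
  have "subgroup ?S G"
  proof (rule subgroupI)
    show "?S \<noteq> {}" using sub by (auto intro!: exI[of _ \<one>] simp: lcos_mult_one)
    show "inv x \<in> ?S" if "x \<in> ?S" for x
    proof -
      have "inv x <# (a <# H) = a <# H"
        using that lcos_m_assoc[OF sub, of "inv x" x] lcos_mult_one[OF sub] by auto
      then show ?thesis using that by simp
    qed
    show "x \<otimes> y \<in> ?S" if "x \<in> ?S" "y \<in> ?S" for x y
      using that sub by (simp add: lcos_m_assoc[symmetric])
  qed auto
  then show ?thesis using conjugate_eq_stabilizer[OF H a] by simp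
qed

lemma finite_index_conjugate:
  assumes H: "finite_index_subgroup G H" and a: "a \<in> carrier G"
  shows "finite_index_subgroup G (conjugate G a H)"
proof -
  have sg: "subgroup H G" and fin: "finite (lcosets H)"
    using H by (auto simp: finite_index_subgroup_def)
  interpret subgroup H G by (rule sg)
  have "finite (lcosets (conjugate G a H))"
  proof (rule finite_lcosetsI[OF subgroup_conjugate[OF sg a]])
    show "finite ((\<lambda>u. (u \<otimes> a) <# H) ` carrier G)"
      by (rule finite_subset[OF _ fin]) (use a in \<open>auto simp: lcosets_eq_image\<close>)
    show "inv u \<otimes> v \<in> conjugate G a H"
      if "u \<in> carrier G" "v \<in> carrier G" "(u \<otimes> a) <# H = (v \<otimes> a) <# H" for u v
      using that a subset l_coset_eq_iff[OF sg, of "u \<otimes> a" "v \<otimes> a"]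
      by (auto simp: conjugate_eq inv_mult_group m_assoc)
  qed
  then show ?thesis using subgroup_conjugate[OF sg a] by (simp add: finite_index_subgroup_def)
qed

lemma finite_index_Inter:
  assumes fin: "finite \<H>" and ne: "\<H> \<noteq> {}" and \<H>: "\<And>H. H \<in> \<H> \<Longrightarrow> finite_index_subgroup G H"
  shows "finite_index_subgroup G (\<Inter>\<H>)"
proof -
  have sg: "subgroup (\<Inter>\<H>) G"
    using ne \<H> by (intro subgroups_Inter) (auto simp: finite_index_subgroup_def)
  \<comment> \<open>Tagging each coset with its subgroup lets equality of the sets
    \<open>f u\<close> and \<open>f v\<close> be read off one subgroup at a time.\<close>
  define f where "f u = (\<lambda>H. (H, u <# H)) ` \<H>" for u
  have "finite (lcosets (\<Inter>\<H>))"
  proof (rule finite_lcosetsI[OF sg])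
    have "f ` carrier G \<subseteq> Pow (Sigma \<H> (\<lambda>H. lcosets H))"
      by (auto simp: f_def lcosets_eq_image)
    moreover have "finite (Sigma \<H> (\<lambda>H. lcosets H))"
      using fin \<H> by (intro finite_SigmaI) (auto simp: finite_index_subgroup_def)
    ultimately show "finite (f ` carrier G)" by (meson finite_Pow_iff finite_subset)
    fix u v assume uv: "u \<in> carrier G" "v \<in> carrier G" "f u = f v"
    have "inv u \<otimes> v \<in> H" if H: "H \<in> \<H>" for H
    proof -
      have "(H, u <# H) \<in> f v" using H uv(3) by (auto simp: f_def)
      then have "u <# H = v <# H" by (auto simp: f_def)
      then show ?thesis
        using uv \<H>[OF H] by (simp add: l_coset_eq_iff finite_index_subgroup_def)
    qed
    then show "inv u \<otimes> v \<in> \<Inter>\<H>" by blast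
  qed
  then show ?thesis using sg by (simp add: finite_index_subgroup_def)
qed

text \<open>\<open>N\<close> is the kernel of the action of the group on \<open>lcosets H\<close>.
  The conjugate by \<open>a\<close> depends only on the coset \<open>a <# H\<close>, so finitely
  many conjugates occur.\<close>

lemma normal_core:
  assumes H: "finite_index_subgroup G H"
  defines "N \<equiv> \<Inter>a\<in>carrier G. conjugate G a H"
  shows "finite_index_subgroup G N" "N \<lhd> G" "finite ((\<lambda>a. conjugate G a H) ` carrier G)"
    and "x \<in> N \<longleftrightarrow> x \<in> carrier G \<and> (\<forall>C\<in>lcosets H. x <# C = C)"
proof -
  have sg: "subgroup H G" and fin: "finite (lcosets H)"
    using H by (auto simp: finite_index_subgroup_def)
  interpret subgroup H G by (rule sg)
  have "(\<lambda>a. conjugate G a H) ` carrier G = (\<lambda>C. {x \<in> carrier G. x <# C = C}) ` (lcosets H)"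
    unfolding lcosets_eq_image image_image
    by (rule image_cong) (simp_all add: conjugate_eq_stabilizer[OF sg])
  then show finc: "finite ((\<lambda>a. conjugate G a H) ` carrier G)" using fin by simp
  show fi: "finite_index_subgroup G N"
    unfolding N_def using finc finite_index_conjugate[OF H]
    by (intro finite_index_Inter) auto
  show "x \<in> N \<longleftrightarrow> x \<in> carrier G \<and> (\<forall>C\<in>lcosets H. x <# C = C)"
    by (auto simp: N_def conjugate_eq_stabilizer[OF sg] lcosets_eq_image)
  have "x \<otimes> h \<otimes> inv x \<in> conjugate G a H"
    if "x \<in> carrier G" "h \<in> N" "a \<in> carrier G" for x h a
  proof -
    have "h \<in> conjugate G (inv x \<otimes> a) H" using that by (auto simp: N_def)
    then show ?thesis
      using that subset by (auto simp: conjugate_eq inv_mult_group m_assoc)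
  qed
  then show "N \<lhd> G"
    using fi by (auto simp: normal_inv_iff finite_index_subgroup_def N_def)
qed

lemma bi_invariant_algebra_Pow: "bi_invariant_algebra G (Pow (carrier G))"
  by (auto simp: bi_invariant_algebra_def left_invariant_algebra_def algebra_iff_Int
      l_coset_eq r_coset_eq)

text \<open>The power set is itself a bi-invariant algebra, so the intersection defining the hull
  runs over a nonempty family of sets within the carrier.\<close>

lemma bi_invariant_hull:
  assumes B: "B \<subseteq> Pow (carrier G)"
  shows "bi_invariant_algebra G (bi_invariant_hull G B)"
    and "B \<subseteq> bi_invariant_hull G B"
proof -
  have "bi_invariant_hull G B \<subseteq> Pow (carrier G)"
    using B bi_invariant_algebra_Pow by (auto simp: bi_invariant_hull_def)
  then show "bi_invariant_algebra G (bi_invariant_hull G B)"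
    by (auto simp: bi_invariant_hull_def bi_invariant_algebra_def left_invariant_algebra_def
        algebra_iff_Int)
  show "B \<subseteq> bi_invariant_hull G B" by (auto simp: bi_invariant_hull_def)
qed

lemma bi_invariant_hull_least:
  "bi_invariant_algebra G C \<Longrightarrow> B \<subseteq> C \<Longrightarrow> bi_invariant_hull G B \<subseteq> C"
  by (auto simp: bi_invariant_hull_def)

end

section \<open>Sets determined by cosets up to null sets\<close>

context stable_prob
begin

lemma measure_lcoset:
  assumes K: "finite_index_subgroup G K" "K \<in> M" and C: "C \<in> lcosets K"
  shows "C \<in> M" "\<mu> C = 1 / card (lcosets K)" "0 < \<mu> C"
proof -
  have sg: "subgroup K G" and fin: "finite (lcosets K)"
    using K by (auto simp: finite_index_subgroup_def)
  have eq: "C \<in> M" "\<mu> C = \<mu> K" if "C \<in> lcosets K" for C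
    using that K(2) by (auto simp: lcosets_eq_image)
  then show "C \<in> M" using C by blast
  have "\<mu> (\<Union>C\<in>lcosets K. C) = (\<Sum>C\<in>lcosets K. \<mu> C)"
    using fin eq lcos_disjoint[OF sg]
    by (intro measure_UN_disjoint) (auto simp: disjoint_family_on_def)
  then have "card (lcosets K) * \<mu> K = 1"
    using eq lcosets_part_G[OF sg] total by simp
  moreover have card: "card (lcosets K) > 0" using C fin by (auto simp: card_gt_0_iff)
  ultimately show "\<mu> C = 1 / card (lcosets K)" using eq[OF C] by (simp add: field_simps)
  then show "0 < \<mu> C" using card by simp
qed

text \<open>This is the union \<open>Y\<close> in (2), formed for an arbitrary subgroup
  \<open>K\<close>.\<close>

definition coset_support :: "'a set \<Rightarrow> 'a set \<Rightarrow> 'a set" where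
  "coset_support K X = \<Union>{C \<in> lcosets K. 0 < \<mu> (C \<inter> X)}"

lemma coset_support:
  assumes K: "finite_index_subgroup G K" "K \<in> M" and X: "X \<in> M"
    and unsplit: "\<And>C. C \<in> lcosets K \<Longrightarrow> \<mu> (C \<inter> X) = 0 \<or> \<mu> (C - X) = 0"
  shows "coset_support K X \<in> M" "aeq X (coset_support K X)"
    and "\<mu> (coset_support K X) = card {C \<in> lcosets K. 0 < \<mu> (C \<inter> X)} / card (lcosets K)"
proof -
  let ?\<C> = "{C \<in> lcosets K. 0 < \<mu> (C \<inter> X)}"
  have sg: "subgroup K G" and fin: "finite (lcosets K)"
    using K by (auto simp: finite_index_subgroup_def)
  note CM = measure_lcoset(1)[OF K]
  show SM: "coset_support K X \<in> M"
    unfolding coset_support_def using fin CM by (intro finite_Union) auto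
  have "\<mu> (X - coset_support K X) = 0"
  proof (rule null_subset)
    have "X \<subseteq> \<Union>(lcosets K)" using stable_carrier[OF X] lcosets_part_G[OF sg] by blast
    then show "X - coset_support K X \<subseteq> (\<Union>C\<in>lcosets K - ?\<C>. C \<inter> X)"
      by (auto simp: coset_support_def)
    show "\<mu> (\<Union>C\<in>lcosets K - ?\<C>. C \<inter> X) = 0"
    proof (rule null_UN)
      fix C assume C: "C \<in> lcosets K - ?\<C>"
      then show "C \<inter> X \<in> M" using CM X by auto
      then show "\<mu> (C \<inter> X) = 0" using C nonneg[of "C \<inter> X"] by auto
    qed (use fin in simp)
    show "X - coset_support K X \<in> M" by (intro Diff X SM)
    show "(\<Union>C\<in>lcosets K - ?\<C>. C \<inter> X) \<in> M" using X CM fin by (intro finite_UN) auto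
  qed
  moreover have "\<mu> (coset_support K X - X) = 0"
  proof (rule null_subset)
    show "coset_support K X - X \<subseteq> (\<Union>C\<in>?\<C>. C - X)" by (auto simp: coset_support_def)
    show "\<mu> (\<Union>C\<in>?\<C>. C - X) = 0"
    proof (rule null_UN)
      fix C assume C: "C \<in> ?\<C>"
      then show "C - X \<in> M" using CM X by auto
      show "\<mu> (C - X) = 0" using C unsplit[of C] by auto
    qed (use fin in simp)
    show "coset_support K X - X \<in> M" by (intro Diff X SM)
    show "(\<Union>C\<in>?\<C>. C - X) \<in> M" using X CM fin by (intro finite_UN) auto
  qed
  ultimately show "aeq X (coset_support K X)" using X SM by (simp add: aeq_iff)
  have "\<mu> (\<Union>C\<in>?\<C>. C) = (\<Sum>C\<in>?\<C>. \<mu> C)"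
    using fin CM lcos_disjoint[OF sg]
    by (intro measure_UN_disjoint) (auto simp: disjoint_family_on_def)
  also have "\<dots> = (\<Sum>C\<in>?\<C>. 1 / card (lcosets K))"
    by (intro sum.cong) (auto simp: measure_lcoset[OF K])
  finally show "\<mu> (coset_support K X) = card ?\<C> / card (lcosets K)"
    by (simp add: coset_support_def)
qed

text \<open>Up to a null set \<open>X\<close> is its coset support, a union of cosets that
  \<open>n\<close> fixes one by one; hence \<open>n <# X\<close> and \<open>X\<close> agree up to a
  null set with the same union.\<close>

lemma measure_stabI:
  assumes K: "finite_index_subgroup G K" "K \<in> M" and X: "X \<in> M"
    and unsplit: "\<And>C. C \<in> lcosets K \<Longrightarrow> \<mu> (C \<inter> X) = 0 \<or> \<mu> (C - X) = 0"
    and n: "n \<in> carrier G" "\<And>C. C \<in> lcosets K \<Longrightarrow> n <# C = C"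
  shows "n \<in> measure_stab G \<mu> X"
proof -
  let ?Y = "coset_support K X"
  have Y: "?Y \<in> M" "aeq X ?Y" using coset_support[OF K X unsplit] by auto
  have "x \<in> n <# ?Y \<longleftrightarrow> x \<in> ?Y" for x
  proof -
    have "x \<in> n <# ?Y \<longleftrightarrow> x \<in> carrier G \<and> inv n \<otimes> x \<in> ?Y"
      using n(1) stable_carrier[OF Y(1)] by (simp add: l_coset_eq)
    also have "\<dots> \<longleftrightarrow> (\<exists>C\<in>{C \<in> lcosets K. 0 < \<mu> (C \<inter> X)}. x \<in> carrier G \<and> inv n \<otimes> x \<in> C)"
      by (auto simp: coset_support_def)
    also have "\<dots> \<longleftrightarrow> (\<exists>C\<in>{C \<in> lcosets K. 0 < \<mu> (C \<inter> X)}. x \<in> n <# C)"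
      using n(1) measure_lcoset(1)[OF K] by (auto simp: l_coset_eq stable_carrier)
    also have "\<dots> \<longleftrightarrow> x \<in> ?Y" using n(2) by (auto simp: coset_support_def)
    finally show ?thesis .
  qed
  then have nY: "n <# ?Y = ?Y" by blast
  have "aeq (n <# X) ?Y" using aeq_l_coset[OF n(1) X Y] nY by simp
  then have "aeq (n <# X) X"
    using n(1) X Y by (intro aeq_trans[of "n <# X" ?Y X]) (auto simp: aeq_sym)
  then show ?thesis using n(1) by (simp add: measure_stab_eq)
qed

end

section \<open>Generic types and the component\<close>

locale stable_algebra_prob = stable_prob +
  fixes B :: "'a set set"
  assumes B_stable: "B \<subseteq> stable_sets G"
    and left_invariant: "left_invariant_algebra G B"
    and finite_component: "finite (lcosets (component G B))"
begin

sublocale B: Sigma_Algebra.algebra "carrier G" B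
  by (rule left_invariant_algebraD[OF left_invariant])

abbreviation "G0 \<equiv> component G B"
abbreviation "Bs \<equiv> bi_invariant_hull G B"

definition core :: "'a set" where "core = (\<Inter>a\<in>carrier G. conjugate G a G0)"

lemma B_stableD: "A \<in> B \<Longrightarrow> A \<in> M"
  using B_stable by blast

lemma l_coset_B: "g \<in> carrier G \<Longrightarrow> A \<in> B \<Longrightarrow> g <# A \<in> B"
  by (rule left_invariant_algebraD[OF left_invariant])

lemmas G0_finite_index = finite_index_component(1)[OF left_invariant finite_component]
lemmas G0_B = finite_index_component(2)[OF left_invariant finite_component]

lemma subgroup_G0: "subgroup G0 G"
  using G0_finite_index by (simp add: finite_index_subgroup_def)

lemma lcoset_B: "C \<in> lcosets G0 \<Longrightarrow> C \<in> B"
  using G0_B l_coset_B by (auto simp: lcosets_eq_image)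

lemmas measure_lcoset_G0 = measure_lcoset[OF G0_finite_index B_stableD[OF G0_B]]

text \<open>\<open>right_stab X\<close> is a finite-index subgroup in \<open>B\<close>, so the
  component is contained in it by definition.\<close>

lemma G0_unsplit:
  assumes X: "X \<in> B" and C: "C \<in> lcosets G0"
  shows "\<mu> (C \<inter> X) = 0 \<or> \<mu> (C - X) = 0"
proof (rule lcoset_unsplit[OF subgroup_G0 B_stableD[OF G0_B] B_stableD[OF X] _ C])
  show "G0 \<subseteq> right_stab X"
    using right_stab_finite_index[OF left_invariant B_stable X] by (auto simp: component_def)
qed

section \<open>The component of the bi-invariant hull\<close>

lemmas core_normal = normal_core(2)[OF G0_finite_index, folded core_def]
lemmas core_finite_index = normal_core(1)[OF G0_finite_index, folded core_def]
lemmas core_iff = normal_core(4)[OF G0_finite_index, folded core_def]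

lemma subgroup_core: "subgroup core G"
  using core_finite_index by (simp add: finite_index_subgroup_def)

lemma B_Pow: "B \<subseteq> Pow (carrier G)"
  by (rule B.space_closed)

lemmas hull_bi_invariant = bi_invariant_hull(1)[OF B_Pow]
lemmas B_hull = bi_invariant_hull(2)[OF B_Pow]

lemma conjugate_hull:
  assumes "a \<in> carrier G"
  shows "conjugate G a G0 \<in> Bs"
proof -
  have "G0 \<in> Bs" using G0_B B_hull by blast
  then have "a <# G0 \<in> Bs"
    using assms left_invariant_algebraD(2)[OF bi_invariant_algebraD(1)[OF hull_bi_invariant]] by blast
  then show ?thesis
    unfolding conjugate_def using assms bi_invariant_algebraD(2)[OF hull_bi_invariant] by blast
qed

lemma core_hull: "core \<in> Bs"
proof -
  interpret Bs: Sigma_Algebra.algebra "carrier G" Bs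
    by (intro left_invariant_algebraD bi_invariant_algebraD hull_bi_invariant)
  have "(\<Inter>H\<in>(\<lambda>a. conjugate G a G0) ` carrier G. H) \<in> Bs"
    using normal_core(3)[OF G0_finite_index] conjugate_hull by (intro Bs.finite_INT) auto
  then show ?thesis by (simp add: core_def)
qed

lemma hull_stable: "Bs \<subseteq> M"
  by (rule bi_invariant_hull_least[OF bi_invariant_algebra_stable_sets B_stable])

lemma core_M: "core \<in> M"
  using core_hull hull_stable by blast

lemma core_sub_G0: "core \<subseteq> G0"
proof -
  have "conjugate G \<one> G0 = G0"
    using subgroup.subset[OF subgroup_G0] by (auto simp: conjugate_eq)
  then show ?thesis by (auto simp: core_def)
qed

text \<open>The delicate closure property of \<open>\<D>\<close> is right translation, which must
  carry left cosets of \<open>core\<close> to left cosets; this is where normality of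
  \<open>core\<close> enters. The members of \<open>B\<close> belong to \<open>\<D>\<close> because
  every coset of \<open>core\<close> lies inside a coset of \<open>G0\<close>.\<close>

lemma core_unsplit:
  assumes A: "A \<in> Bs" and c: "c \<in> carrier G"
  shows "\<mu> ((c <# core) \<inter> A) = 0 \<or> \<mu> ((c <# core) - A) = 0"
proof -
  define \<D> where "\<D> = {A \<in> M. \<forall>c\<in>carrier G. \<mu> ((c <# core) \<inter> A) = 0 \<or> \<mu> ((c <# core) - A) = 0}"
  have cM: "c <# core \<in> M" if "c \<in> carrier G" for c using that core_M by simp
  have csub: "c <# core \<subseteq> carrier G" if "c \<in> carrier G" for c using cM[OF that] stable_carrier by blast
  have "bi_invariant_algebra G \<D>"
    unfolding bi_invariant_algebra_def left_invariant_algebra_def algebra_iff_Int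
  proof (intro conjI ballI)
    show "\<D> \<subseteq> Pow (carrier G)" using stable_carrier by (auto simp: \<D>_def)
    show "{} \<in> \<D>" by (auto simp: \<D>_def)
    show "carrier G - A \<in> \<D>" if "A \<in> \<D>" for A
    proof -
      have "(c <# core) \<inter> (carrier G - A) = (c <# core) - A"
        "(c <# core) - (carrier G - A) = (c <# core) \<inter> A" if "c \<in> carrier G" for c
        using csub[OF that] by blast+
      then show ?thesis using that by (auto simp: \<D>_def)
    qed
    show "A \<inter> A' \<in> \<D>" if A: "A \<in> \<D>" and A': "A' \<in> \<D>" for A A'
    proof -
      have AM: "A \<in> M" "A' \<in> M" using A A' by (auto simp: \<D>_def)
      have "\<mu> ((c <# core) \<inter> (A \<inter> A')) = 0 \<or> \<mu> ((c <# core) - A \<inter> A') = 0"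
        if c: "c \<in> carrier G" for c
      proof -
        consider "\<mu> ((c <# core) \<inter> A) = 0" | "\<mu> ((c <# core) \<inter> A') = 0"
          | "\<mu> ((c <# core) - A) = 0" "\<mu> ((c <# core) - A') = 0"
          using A A' c by (auto simp: \<D>_def)
        then show ?thesis
        proof cases
          case 1
          then show ?thesis
            by (intro disjI1 null_subset[of "(c <# core) \<inter> (A \<inter> A')" "(c <# core) \<inter> A"] Int cM c AM)
              blast+
        next
          case 2
          then show ?thesis
            by (intro disjI1 null_subset[of "(c <# core) \<inter> (A \<inter> A')" "(c <# core) \<inter> A'"] Int cM c AM)
              blast+
        next
          case 3
          then have "\<mu> (((c <# core) - A) \<union> ((c <# core) - A')) = 0"
            by (intro null_Un Diff cM c AM)
          then show ?thesis by (simp add: Diff_Int)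
        qed
      qed
      then show ?thesis using AM by (auto simp: \<D>_def)
    qed
    fix g A assume g: "g \<in> carrier G" and A: "A \<in> \<D>"
    have AM: "A \<in> M" using A by (auto simp: \<D>_def)
    have "\<mu> ((c <# core) \<inter> (g <# A)) = 0 \<or> \<mu> ((c <# core) - (g <# A)) = 0" if c: "c \<in> carrier G" for c
    proof -
      have "c <# core = g <# ((inv g \<otimes> c) <# core)"
        using g c stable_carrier[OF core_M] by (simp add: lcos_m_assoc m_assoc[symmetric])
      then have "(c <# core) \<inter> (g <# A) = g <# (((inv g \<otimes> c) <# core) \<inter> A)"
        "(c <# core) - (g <# A) = g <# (((inv g \<otimes> c) <# core) - A)"
        using g c AM cM by (simp_all add: l_coset_Int l_coset_Diff stable_carrier)
      then show ?thesis
        using A g c AM cM by (auto simp: \<D>_def Int Diff)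
    qed
    then show "g <# A \<in> \<D>" using g AM by (simp add: \<D>_def)
    have "\<mu> ((c <# core) \<inter> (A #> g)) = 0 \<or> \<mu> ((c <# core) - (A #> g)) = 0" if c: "c \<in> carrier G" for c
    proof -
      have "c <# core = (c <# core) #> inv g #> g"
        using g csub[OF c] by (simp add: coset_mult_assoc)
      moreover have "(c <# core) #> inv g = (c \<otimes> inv g) <# core"
        using g c normal.coset_eq[OF core_normal] stable_carrier[OF core_M]
        by (metis coset_assoc inv_closed lcos_m_assoc)
      ultimately have "c <# core = ((c \<otimes> inv g) <# core) #> g" by simp
      then have "(c <# core) \<inter> (A #> g) = (((c \<otimes> inv g) <# core) \<inter> A) #> g"
        "(c <# core) - (A #> g) = (((c \<otimes> inv g) <# core) - A) #> g"
        using g c AM cM by (simp_all add: r_coset_Int r_coset_Diff stable_carrier)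
      then show ?thesis
        using A g c AM cM by (auto simp: \<D>_def Int Diff)
    qed
    then show "A #> g \<in> \<D>" using g AM by (simp add: \<D>_def)
  qed
  moreover have "B \<subseteq> \<D>"
  proof
    fix X assume X: "X \<in> B"
    have "\<mu> ((c <# core) \<inter> X) = 0 \<or> \<mu> ((c <# core) - X) = 0" if c: "c \<in> carrier G" for c
    proof -
      have sub: "c <# core \<subseteq> c <# G0" using core_sub_G0 by (auto simp: l_coset_def)
      have C: "c <# G0 \<in> lcosets G0" using c by (auto simp: lcosets_eq_image)
      note CM = measure_lcoset_G0(1)[OF C]
      from G0_unsplit[OF X C] show ?thesis
      proof
        assume "\<mu> ((c <# G0) \<inter> X) = 0"
        then show ?thesis using sub
          by (intro disjI1 null_subset[of "(c <# core) \<inter> X" "(c <# G0) \<inter> X"] Int cM c CM B_stableD X) blast+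
      next
        assume "\<mu> ((c <# G0) - X) = 0"
        then show ?thesis using sub
          by (intro disjI2 null_subset[of "(c <# core) - X" "(c <# G0) - X"] Diff cM c CM B_stableD X) blast+
      qed
    qed
    then show "X \<in> \<D>" using X B_stableD by (auto simp: \<D>_def)
  qed
  ultimately have "Bs \<subseteq> \<D>" by (rule bi_invariant_hull_least)
  then show ?thesis using A c by (auto simp: \<D>_def)
qed

text \<open>Let \<open>H\<close> be a finite-index subgroup in the hull. Then
  \<open>core \<inter> H\<close> has finite index, hence positive measure, so
  \<open>core - H\<close> is null. A point \<open>n\<close> of \<open>core - H\<close> would put the
  translate \<open>n <# (core \<inter> H)\<close>, of positive measure, inside this null
  set.\<close>

lemma component_hull: "component G Bs = core"
proof
  show "component G Bs \<subseteq> core"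
    using conjugate_hull finite_index_conjugate[OF G0_finite_index]
    by (auto simp: component_def core_def)
  show "core \<subseteq> component G Bs"
    unfolding component_def
  proof (intro Inter_greatest)
    fix H assume "H \<in> {H. finite_index_subgroup G H \<and> H \<in> Bs}"
    then have H: "finite_index_subgroup G H" "H \<in> Bs" "subgroup H G"
      by (auto simp: finite_index_subgroup_def)
    have HM: "H \<in> M" using H hull_stable by blast
    have one_core: "\<one> <# core = core" using stable_carrier[OF core_M] by (rule lcos_mult_one)
    have "finite_index_subgroup G (\<Inter>{core, H})"
      using core_finite_index H by (intro finite_index_Inter) auto
    then have fi: "finite_index_subgroup G (core \<inter> H)" by simp
    have IM: "core \<inter> H \<in> M" using core_M HM by auto
    have coset: "n <# (core \<inter> H) \<in> lcosets (core \<inter> H)" if "n \<in> carrier G" for n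
      using that by (auto simp: lcosets_eq_image)
    have pos: "0 < \<mu> (n <# (core \<inter> H))" if "n \<in> carrier G" for n
      using measure_lcoset(3)[OF fi IM coset[OF that]] .
    have "\<mu> (core \<inter> H) \<noteq> 0" using pos[of \<one>] IM by simp
    then have null: "\<mu> (core - H) = 0" using core_unsplit[OF H(2) one_closed] one_core by simp
    show "core \<subseteq> H"
    proof (rule ccontr)
      assume "\<not> core \<subseteq> H"
      then obtain n where n: "n \<in> core" "n \<notin> H" by blast
      then have nG: "n \<in> carrier G" using stable_carrier[OF core_M] by blast
      have "n <# (core \<inter> H) \<subseteq> core - H"
      proof
        fix x assume "x \<in> n <# (core \<inter> H)"
        then obtain h where h: "h \<in> core" "h \<in> H" "x = n \<otimes> h" by (auto simp: l_coset_def)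
        have "x \<in> core" using h n subgroup.m_closed[OF subgroup_core] by simp
        moreover have "x \<notin> H"
        proof
          assume "x \<in> H"
          then have "x \<otimes> inv h \<in> H" using h H(3) by (simp add: subgroup_def)
          moreover have "x \<otimes> inv h = n"
            using h nG subgroup.subset[OF H(3)] by (auto simp: m_assoc subset_iff)
          ultimately show False using n by simp
        qed
        ultimately show "x \<in> core - H" by blast
      qed
      then have "\<mu> (n <# (core \<inter> H)) = 0"
        using null nG by (intro null_subset[of "n <# (core \<inter> H)" "core - H"] stable_l_coset IM Diff core_M HM)
      then show False using pos[OF nG] by simp
    qed
  qed
qed

lemma measure_stab_finite_index:
  assumes X: "X \<in> B"
  shows "core \<subseteq> measure_stab G \<mu> X" "finite_index_subgroup G (measure_stab G \<mu> X)"
    "measure_stab G \<mu> X \<in> Bs"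
proof -
  note sg = subgroup_measure_stab[OF B_stableD[OF X]]
  show sub: "core \<subseteq> measure_stab G \<mu> X"
  proof
    fix n assume "n \<in> core"
    then show "n \<in> measure_stab G \<mu> X"
      by (intro measure_stabI[OF G0_finite_index B_stableD[OF G0_B] B_stableD[OF X] G0_unsplit[OF X]])
        (auto simp: core_iff)
  qed
  show "finite_index_subgroup G (measure_stab G \<mu> X)"
    using core_finite_index sg sub
    by (intro finite_index_mono[of core]) (auto simp: finite_index_subgroup_def)
  show "measure_stab G \<mu> X \<in> Bs"
  \<comment> \<open>A subgroup that contains \<open>core\<close> is a union of its left cosets, and
    \<open>core\<close> lies in the hull.\<close>
  proof (rule union_of_lcosets_in_algebra[of Bs core])
    show "left_invariant_algebra G Bs" by (rule bi_invariant_algebraD[OF hull_bi_invariant])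
    show "s <# core \<subseteq> measure_stab G \<mu> X" if "s \<in> measure_stab G \<mu> X" for s
      using that sub subgroup.m_closed[OF sg] by (auto simp: l_coset_def)
  qed (use core_finite_index core_hull sg in \<open>auto simp: finite_index_subgroup_def subgroup.subset\<close>)
qed

text \<open>For the inclusion from right to left it suffices to test \<open>X\<close> on the left
  cosets of \<open>G0\<close>, which belong to \<open>B\<close>: a coset that \<open>g\<close> moves
  becomes disjoint from itself, and cosets have positive measure.\<close>

lemma core_eq_Inter_measure_stab: "core = (\<Inter>X\<in>B. measure_stab G \<mu> X)"
proof
  show "core \<subseteq> (\<Inter>X\<in>B. measure_stab G \<mu> X)" using measure_stab_finite_index by blast
  show "(\<Inter>X\<in>B. measure_stab G \<mu> X) \<subseteq> core"
  proof
    fix g assume g: "g \<in> (\<Inter>X\<in>B. measure_stab G \<mu> X)"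
    then have gG: "g \<in> carrier G" using G0_B by (auto simp: measure_stab_def)
    have "g <# C = C" if C: "C \<in> lcosets G0" for C
    proof (rule ccontr)
      assume ne: "g <# C \<noteq> C"
      obtain c where c: "c \<in> carrier G" "C = c <# G0" using C by (auto simp: lcosets_eq_image)
      have "g <# C = (g \<otimes> c) <# G0"
        using c gG subgroup.subset[OF subgroup_G0] by (simp add: lcos_m_assoc)
      then have gC: "g <# C \<in> lcosets G0" using c gG by (auto simp: lcosets_eq_image)
      have "(g <# C) - C = g <# C" using lcos_disjoint[OF subgroup_G0 gC C ne] by blast
      moreover have "\<mu> ((g <# C) - C) = 0"
        using g lcoset_B[OF C] measure_lcoset_G0(1)[OF C] gG
        by (auto simp: measure_stab_eq aeq_iff)
      ultimately show False using measure_lcoset_G0(3)[OF gC] by simp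
    qed
    then show "g \<in> core" using gG by (simp add: core_iff)
  qed
qed


section \<open>Generic types as left cosets of \<open>G0\<close>\<close>

definition coset_type :: "'a set \<Rightarrow> 'a set set" where
  "coset_type C = {A \<in> B. \<mu> (C - A) = 0}"

text \<open>Completeness of the type is the fact that members of \<open>B\<close> do not split
  \<open>C\<close>; genericity of its members comes from the positive measure of
  \<open>C\<close>.\<close>

lemma coset_type_generic:
  assumes C: "C \<in> lcosets G0"
  shows "coset_type C \<in> generic_types G B"
  unfolding generic_types_def is_type_def mem_Collect_eq
proof (intro conjI ballI)
  note CM = measure_lcoset_G0(1)[OF C] and pos = measure_lcoset_G0(3)[OF C]
  show "coset_type C \<subseteq> B" by (auto simp: coset_type_def)
  show "{} \<notin> coset_type C" using pos by (simp add: coset_type_def)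
  show "A \<inter> A' \<in> coset_type C" if A: "A \<in> coset_type C" and A': "A' \<in> coset_type C" for A A'
  proof -
    have AB: "A \<in> B" "A' \<in> B" using A A' by (auto simp: coset_type_def)
    have "\<mu> ((C - A) \<union> (C - A')) = 0"
      using A A' by (intro null_Un Diff CM B_stableD AB) (auto simp: coset_type_def)
    then show ?thesis using AB by (simp add: coset_type_def Diff_Int B.Int)
  qed
  show "A \<in> coset_type C \<or> carrier G - A \<in> coset_type C" if A: "A \<in> B" for A
  proof -
    have "C - (carrier G - A) = C \<inter> A" using stable_carrier[OF CM] by blast
    then show ?thesis using G0_unsplit[OF A C] A B.compl_sets by (auto simp: coset_type_def)
  qed
  show "generic_in G A" if "A \<in> coset_type C" for A
  proof -
    have A: "A \<in> M" "\<mu> (C - A) = 0" using that B_stableD by (auto simp: coset_type_def)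
    have "\<mu> C = \<mu> (C \<inter> A)" using measure_split[OF CM A(1)] A(2) by simp
    also have "\<dots> \<le> \<mu> A" by (intro measure_mono Int CM A) blast
    finally show ?thesis using pos generic_in_iff_measure_pos[OF A(1)] by simp
  qed
qed

lemma generic_typeD:
  assumes "p \<in> generic_types G B"
  shows "A \<in> p \<Longrightarrow> A \<in> B" "{} \<notin> p" "A \<in> p \<Longrightarrow> A' \<in> p \<Longrightarrow> A \<inter> A' \<in> p"
    "A \<in> B \<Longrightarrow> A \<in> p \<or> carrier G - A \<in> p" "A \<in> p \<Longrightarrow> 0 < \<mu> A"
proof -
  have *: "is_type G B p" "\<And>A. A \<in> p \<Longrightarrow> generic_in G A"
    using assms by (auto simp: generic_types_def)
  then show "A \<in> p \<Longrightarrow> A \<in> B" "{} \<notin> p" "A \<in> p \<Longrightarrow> A' \<in> p \<Longrightarrow> A \<inter> A' \<in> p"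
    "A \<in> B \<Longrightarrow> A \<in> p \<or> carrier G - A \<in> p"
    by (auto simp: is_type_def)
  then show "A \<in> p \<Longrightarrow> 0 < \<mu> A" using *(2) B_stableD generic_in_iff_measure_pos by blast
qed

text \<open>Every \<open>A \<in> p\<close> meets \<open>C\<close> in a member of \<open>p\<close>,
  hence in positive measure, and since \<open>A\<close> cannot split \<open>C\<close> it contains
  \<open>C\<close> up to a null set. The other inclusion applies the same positivity to the
  complement of \<open>A\<close>.\<close>

lemma generic_type_eq:
  assumes p: "p \<in> generic_types G B" and C: "C \<in> lcosets G0" "C \<in> p"
  shows "p = coset_type C"
proof
  note pD = generic_typeD[OF p] and CM = measure_lcoset_G0(1)[OF C(1)]
  show "p \<subseteq> coset_type C"
  proof
    fix A assume A: "A \<in> p"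
    then have "0 < \<mu> (C \<inter> A)" using pD(3,5) C(2) by blast
    then show "A \<in> coset_type C"
      using G0_unsplit[OF pD(1)[OF A] C(1)] pD(1)[OF A] by (auto simp: coset_type_def)
  qed
  show "coset_type C \<subseteq> p"
  proof
    fix A assume A: "A \<in> coset_type C"
    show "A \<in> p"
    proof (rule ccontr)
      assume "A \<notin> p"
      then have "carrier G - A \<in> p" using pD(4) A by (auto simp: coset_type_def)
      then have "0 < \<mu> (C \<inter> (carrier G - A))" using pD(3,5) C(2) by blast
      moreover have "C \<inter> (carrier G - A) = C - A" using stable_carrier[OF CM] by blast
      ultimately show False using A by (simp add: coset_type_def)
    qed
  qed
qed

text \<open>Otherwise \<open>p\<close> would contain the complements of all cosets, and their finite
  intersection is empty.\<close>

lemma generic_type_contains_coset: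
  assumes p: "p \<in> generic_types G B"
  obtains C where "C \<in> lcosets G0" "C \<in> p"
proof (rule ccontr)
  note pD = generic_typeD[OF p]
  assume "\<not> thesis"
  then have compl: "carrier G - C \<in> p" if "C \<in> lcosets G0" for C
    using pD(4)[OF lcoset_B[OF that]] that \<open>\<And>C. C \<in> lcosets G0 \<Longrightarrow> C \<in> p \<Longrightarrow> thesis\<close> by blast
  have "carrier G - \<Union>\<S> \<in> p" if "finite \<S>" "\<S> \<subseteq> lcosets G0" for \<S>
    using that
  proof (induction \<S> rule: finite_induct)
    case empty
    then show ?case using pD(4)[of "carrier G"] pD(2) B.top by auto
  next
    case (insert C \<S>)
    then have "(carrier G - C) \<inter> (carrier G - \<Union>\<S>) \<in> p" using compl pD(3) by blast
    moreover have "(carrier G - C) \<inter> (carrier G - \<Union>\<S>) = carrier G - \<Union>(insert C \<S>)" by blast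
    ultimately show ?case by simp
  qed
  then have "carrier G - \<Union>(lcosets G0) \<in> p" using finite_component by blast
  then show False using pD(2) lcosets_part_G[OF subgroup_G0] by simp
qed

text \<open>Justifies the definite description: two cosets in \<open>p\<close> have an intersection
  in \<open>p\<close>, which is nonempty, so they coincide.\<close>

lemma type_coset_eq:
  assumes p: "p \<in> generic_types G B" and C: "C \<in> lcosets G0" "C \<in> p"
  shows "type_coset G G0 p = C"
  unfolding type_coset_def
proof (rule the_equality)
  fix D assume D: "D \<in> lcosets G0 \<and> D \<in> p"
  then have "D \<inter> C \<noteq> {}" using generic_typeD(2,3)[OF p] C(2) by metis
  then show "D = C" using lcos_disjoint[OF subgroup_G0] D C by blast
qed (use C in simp)

lemma coset_type_self: "C \<in> lcosets G0 \<Longrightarrow> C \<in> coset_type C"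
  using lcoset_B by (simp add: coset_type_def)

lemma type_coset_coset_type: "C \<in> lcosets G0 \<Longrightarrow> type_coset G G0 (coset_type C) = C"
  by (intro type_coset_eq coset_type_generic coset_type_self)

lemma generic_type_cases:
  assumes p: "p \<in> generic_types G B"
  obtains C where "C \<in> lcosets G0" "p = coset_type C" "type_coset G G0 p = C"
proof -
  obtain C where C: "C \<in> lcosets G0" "C \<in> p" by (rule generic_type_contains_coset[OF p])
  show thesis using that[OF C(1) generic_type_eq[OF p C] type_coset_eq[OF p C]] .
qed

lemma bij_betw_type_coset: "bij_betw (type_coset G G0) (generic_types G B) (lcosets G0)"
proof (rule bij_betwI[of _ _ _ coset_type])
  show "type_coset G G0 \<in> generic_types G B \<rightarrow> lcosets G0"
    using generic_type_cases by (metis Pi_I)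
  show "coset_type (type_coset G G0 p) = p" if "p \<in> generic_types G B" for p
    using that by (metis generic_type_cases)
qed (auto simp: coset_type_generic type_coset_coset_type)

lemma lcoset_translate: "g \<in> carrier G \<Longrightarrow> C \<in> lcosets G0 \<Longrightarrow> g <# C \<in> lcosets G0"
  using subgroup.subset[OF subgroup_G0] by (auto simp: lcosets_eq_image lcos_m_assoc)

lemma type_act_coset_type:
  assumes g: "g \<in> carrier G" and C: "C \<in> lcosets G0"
  shows "type_act G g (coset_type C) = coset_type (g <# C)"
proof -
  \<comment> \<open>One inclusion is proved for all \<open>g\<close> and \<open>C\<close>; applied
    to \<open>inv g\<close> and \<open>g <# C\<close> it gives the reverse one.\<close>
  have sub: "type_act G g (coset_type C) \<subseteq> coset_type (g <# C)"
    if g: "g \<in> carrier G" and C: "C \<in> lcosets G0" for g C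
  proof
    fix A assume "A \<in> type_act G g (coset_type C)"
    then obtain A' where A': "A' \<in> B" "\<mu> (C - A') = 0" "A = g <# A'"
      by (auto simp: type_act_def coset_type_def)
    have "(g <# C) - A = g <# (C - A')"
      using g A' measure_lcoset_G0(1)[OF C] B_stableD by (simp add: l_coset_Diff stable_carrier)
    moreover have "C - A' \<in> M" by (intro Diff B_stableD A' lcoset_B C)
    ultimately show "A \<in> coset_type (g <# C)"
      using A' g l_coset_B by (simp add: coset_type_def)
  qed
  show ?thesis
  proof
    show "coset_type (g <# C) \<subseteq> type_act G g (coset_type C)"
    proof
      fix A assume A: "A \<in> coset_type (g <# C)"
      have Csub: "C \<subseteq> carrier G" using measure_lcoset_G0(1)[OF C] by (rule stable_carrier)
      have Asub: "A \<subseteq> carrier G" using A B_stableD stable_carrier by (auto simp: coset_type_def)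
      have "inv g <# A \<in> coset_type (inv g <# (g <# C))"
        using sub[of "inv g" "g <# C"] A g lcoset_translate[OF g C] by (auto simp: type_act_def)
      then have "inv g <# A \<in> coset_type C"
        using g Csub by (simp add: lcos_m_assoc lcos_mult_one)
      moreover have "A = g <# (inv g <# A)"
        using g Asub by (simp add: lcos_m_assoc lcos_mult_one)
      ultimately show "A \<in> type_act G g (coset_type C)" unfolding type_act_def by blast
    qed
  qed (rule sub[OF g C])
qed

lemma type_act_generic:
  assumes g: "g \<in> carrier G" and p: "p \<in> generic_types G B"
  shows "type_act G g p \<in> generic_types G B"
    and "type_coset G G0 (type_act G g p) = g <# type_coset G G0 p"
proof -
  obtain C where C: "C \<in> lcosets G0" "p = coset_type C" "type_coset G G0 p = C"
    by (rule generic_type_cases[OF p])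
  note gC = lcoset_translate[OF g C(1)]
  have act: "type_act G g p = coset_type (g <# C)"
    using type_act_coset_type[OF g C(1)] C(2) by simp
  show "type_act G g p \<in> generic_types G B" using coset_type_generic[OF gC] act by simp
  show "type_coset G G0 (type_act G g p) = g <# type_coset G G0 p"
    using type_coset_coset_type[OF gC] act C(3) by simp
qed

text \<open>Since \<open>type_act\<close> matches translation of cosets and \<open>p\<close> is
  determined by its coset \<open>a <# G0\<close>, the two stabilisers coincide, and that of the
  coset is the conjugate by \<open>a\<close>.\<close>

lemma type_stab_eq_conjugate:
  assumes p: "p \<in> generic_types G B" and a: "a \<in> type_coset G G0 p"
  shows "type_stab G p = conjugate G a G0"
proof -
  obtain C where C: "C \<in> lcosets G0" "p = coset_type C" "type_coset G G0 p = C"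
    by (rule generic_type_cases[OF p])
  have aG: "a \<in> carrier G"
    using a C stable_carrier[OF measure_lcoset_G0(1)[OF C(1)]] by blast
  have "a \<in> a <# G0" using aG subgroup_G0 by (rule lcos_self)
  moreover have "a <# G0 \<in> lcosets G0" using aG by (auto simp: lcosets_eq_image)
  ultimately have Ca: "C = a <# G0" using lcos_disjoint[OF subgroup_G0 C(1)] a C(3) by blast
  have "type_act G g p = p \<longleftrightarrow> g <# C = C" if g: "g \<in> carrier G" for g
    using type_act_coset_type[OF g C(1)] type_coset_coset_type[OF C(1)]
      type_coset_coset_type[OF lcoset_translate[OF g C(1)]] C(2) by metis
  then show ?thesis
    using conjugate_eq_stabilizer[OF subgroup_G0 aG] Ca by (auto simp: type_stab_def)
qed

lemma type_coset_nonempty: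
  assumes p: "p \<in> generic_types G B"
  shows "\<exists>a. a \<in> type_coset G G0 p"
proof -
  obtain C where C: "C \<in> lcosets G0" "type_coset G G0 p = C"
    by (rule generic_type_cases[OF p])
  then show ?thesis using measure_lcoset_G0(3)[OF C(1)] by (cases "C = {}") auto
qed

lemma core_eq_Inter_type_stab: "core = (\<Inter>p\<in>generic_types G B. type_stab G p)"
proof
  show "core \<subseteq> (\<Inter>p\<in>generic_types G B. type_stab G p)"
  proof
    fix n assume n: "n \<in> core"
    have "type_act G n p = p" if p: "p \<in> generic_types G B" for p
    proof -
      obtain C where C: "C \<in> lcosets G0" "p = coset_type C" by (rule generic_type_cases[OF p])
      then show ?thesis using n type_act_coset_type[of n C] by (auto simp: core_iff)
    qed
    then show "n \<in> (\<Inter>p\<in>generic_types G B. type_stab G p)"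
      using n by (auto simp: type_stab_def core_iff)
  qed
  have "(\<Inter>p\<in>generic_types G B. type_stab G p) \<subseteq> conjugate G a G0" if a: "a \<in> carrier G" for a
  proof -
    have C: "a <# G0 \<in> lcosets G0" using a by (auto simp: lcosets_eq_image)
    have "a \<in> type_coset G G0 (coset_type (a <# G0))"
      using type_coset_coset_type[OF C] lcos_self[OF a subgroup_G0] by simp
    then show ?thesis
      using type_stab_eq_conjugate[OF coset_type_generic[OF C]] coset_type_generic[OF C] by blast
  qed
  then show "(\<Inter>p\<in>generic_types G B. type_stab G p) \<subseteq> core" unfolding core_def by blast
qed

end

section \<open>Bi-invariant algebras\<close>

locale bi_stable_algebra_prob = stable_algebra_prob +
  assumes bi_invariant: "bi_invariant_algebra G B"
begin

lemma hull_eq: "Bs = B"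
  using bi_invariant_hull_least[OF bi_invariant, of B] B_hull by blast

text \<open>The source of normality: when the hull adds nothing to \<open>B\<close>, its component
  \<open>core\<close> is \<open>G0\<close> itself.\<close>

lemma core_eq: "core = G0"
  using component_hull hull_eq by simp

lemma G0_normal: "G0 \<lhd> G"
  using core_normal core_eq by simp

lemma lcosets_eq_rcosets: "lcosets G0 = rcosets G0"
  using normal.coset_eq[OF G0_normal] by (auto simp: LCOSETS_def RCOSETS_def)

text \<open>Carries the group structure known for right cosets over to the quotient on left
  cosets.\<close>

lemma LMod_eq_Mod: "G LMod G0 = G Mod G0"
  by (simp add: LFactGroup_def FactGroup_def lcosets_eq_rcosets)

lemma lcoset_set_mult:
  assumes "c \<in> carrier G" "d \<in> carrier G"
  shows "(c <# G0) <#> (d <# G0) = (c \<otimes> d) <# G0"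
  using normal.rcos_sum[OF G0_normal assms] normal.coset_eq[OF G0_normal] assms by auto

text \<open>For the type of \<open>D\<close>, the set dq(A) is \<open>S\<close>, the set of all
  \<open>x\<close> with \<open>(x <# D) - A\<close> null. As \<open>G0\<close> is normal it fixes
  \<open>D\<close> under left translation, so \<open>S\<close> is a union of left cosets of
  \<open>G0\<close>. Hence \<open>S \<in> B\<close>, and \<open>C\<close> is either contained in
  \<open>S\<close> or disjoint from it; the first case says that \<open>A\<close> is conull on
  \<open>c <# D\<close>, which is \<open>C <#> D\<close>.\<close>

lemma type_prod_coset_type:
  assumes C: "C \<in> lcosets G0" and D: "D \<in> lcosets G0"
  shows "type_prod G B (coset_type C) (coset_type D) = coset_type (C <#> D)"
proof -
  interpret G0: subgroup G0 G by (rule subgroup_G0)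
  obtain c where c: "c \<in> carrier G" "C = c <# G0" using C by (auto simp: lcosets_eq_image)
  obtain d where d: "d \<in> carrier G" "D = d <# G0" using D by (auto simp: lcosets_eq_image)
  note CM = measure_lcoset_G0(1)[OF C] and DM = measure_lcoset_G0(1)[OF D]
  have CD: "C <#> D = c <# D"
    using c d lcoset_set_mult G0.subset by (simp add: lcos_m_assoc)
  have "type_def_set G (coset_type D) A \<in> coset_type C \<longleftrightarrow> A \<in> coset_type (C <#> D)"
    if A: "A \<in> B" for A
  proof -
    define S where "S = {x \<in> carrier G. \<mu> ((x <# D) - A) = 0}"
    have "x \<in> type_def_set G (coset_type D) A \<longleftrightarrow> x \<in> S" for x
    proof (cases "x \<in> carrier G")
      case True
      have "(x <# D) - A = x <# (D - (inv x <# A))"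
        using True DM B_stableD[OF A] by (simp add: l_coset_Diff stable_carrier lcos_m_assoc lcos_mult_one)
      moreover have "D - (inv x <# A) \<in> M" using True DM B_stableD[OF A] by (intro Diff) auto
      ultimately show ?thesis
        using True l_coset_B A by (simp add: type_def_set_def S_def coset_type_def)
    qed (simp add: type_def_set_def S_def)
    then have eq: "type_def_set G (coset_type D) A = S" by blast
    have coset: "(x \<otimes> h) <# D = x <# D" if "x \<in> carrier G" "h \<in> G0" for x h
    proof -
      have "h <# D = D" using that core_iff D core_eq by blast
      then show ?thesis
        using that stable_carrier[OF DM] lcos_m_assoc[of D x h] by auto
    qed
    then have sat: "x <# G0 \<subseteq> S" if "x \<in> S" for x
      using that by (auto simp: S_def l_coset_def)
    have SB: "S \<in> B"
      by (rule union_of_lcosets_in_algebra[OF left_invariant subgroup_G0 finite_component G0_B _ sat])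
        (auto simp: S_def)
    have "S \<in> coset_type C \<longleftrightarrow> c \<in> S"
    proof
      assume "c \<in> S"
      then have "C - S = {}" using sat c by blast
      then have "\<mu> (C - S) = 0" by (simp only: measure_empty)
      then show "S \<in> coset_type C" using SB by (simp add: coset_type_def)
    next
      assume S: "S \<in> coset_type C"
      show "c \<in> S"
      proof (rule ccontr)
        assume "c \<notin> S"
        then have "C - S = C"
          using coset c by (auto simp: S_def l_coset_def)
        then show False using S measure_lcoset_G0(3)[OF C] by (simp add: coset_type_def)
      qed
    qed
    then show ?thesis using eq CD c(1) A by (simp add: S_def coset_type_def)
  qed
  then show ?thesis by (auto simp: type_prod_def coset_type_def)
qed

lemma coset_type_iso:
  "coset_type \<in> iso (G LMod G0) (generic_type_group G B)"
  "type_coset G G0 \<in> iso (generic_type_group G B) (G LMod G0)"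
  and group_generic_type_group: "group (generic_type_group G B)"
proof -
  have carr: "carrier (G LMod G0) = lcosets G0" "mult (G LMod G0) = set_mult G" "one (G LMod G0) = G0"
    by (simp_all add: LFactGroup_def)
  have grp: "group (G LMod G0)"
    using normal.factorgroup_is_group[OF G0_normal] LMod_eq_Mod by simp
  then interpret Q: group "G LMod G0" .
  have closed: "C <#> D \<in> lcosets G0" if "C \<in> lcosets G0" "D \<in> lcosets G0" for C D
    using Q.m_closed that by (simp add: carr)
  have "bij_betw coset_type (lcosets G0) (generic_types G B)"
  proof (rule bij_betwI[of _ _ _ "type_coset G G0"])
    show "coset_type (type_coset G G0 p) = p" if "p \<in> generic_types G B" for p
      using that by (metis generic_type_cases)
    show "type_coset G G0 \<in> generic_types G B \<rightarrow> lcosets G0"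
      using bij_betw_type_coset unfolding bij_betw_def by blast
  qed (auto simp: coset_type_generic type_coset_coset_type)
  then show iso: "coset_type \<in> iso (G LMod G0) (generic_type_group G B)"
    by (auto simp: iso_def hom_def carr generic_type_group_def type_prod_coset_type coset_type_generic)
  show "type_coset G G0 \<in> iso (generic_type_group G B) (G LMod G0)"
  proof (rule isoI)
    show "type_coset G G0 \<in> hom (generic_type_group G B) (G LMod G0)"
    proof (rule homI)
      fix p q assume "p \<in> carrier (generic_type_group G B)" "q \<in> carrier (generic_type_group G B)"
      then have p: "p \<in> generic_types G B" and q: "q \<in> generic_types G B"
        by (simp_all add: generic_type_group_def)
      obtain C where C: "C \<in> lcosets G0" "p = coset_type C" "type_coset G G0 p = C"
        by (rule generic_type_cases[OF p])
      obtain D where D: "D \<in> lcosets G0" "q = coset_type D" "type_coset G G0 q = D"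
        by (rule generic_type_cases[OF q])
      show "type_coset G G0 p \<in> carrier (G LMod G0)" using C by (simp add: carr)
      show "type_coset G G0 (p \<otimes>\<^bsub>generic_type_group G B\<^esub> q) =
          type_coset G G0 p \<otimes>\<^bsub>G LMod G0\<^esub> type_coset G G0 q"
        using C D closed
        by (simp add: carr generic_type_group_def type_prod_coset_type type_coset_coset_type)
    qed
    show "bij_betw (type_coset G G0) (carrier (generic_type_group G B)) (carrier (G LMod G0))"
      using bij_betw_type_coset by (simp add: carr generic_type_group_def)
  qed
  have G0: "G0 \<in> lcosets G0" using Q.one_closed by (simp add: carr)
  have unit: "type_prod G B (coset_type G0) p = p \<and> type_prod G B p (coset_type G0) = p"
    if p: "p \<in> generic_types G B" for p
  proof -
    obtain C where C: "C \<in> lcosets G0" "p = coset_type C" by (rule generic_type_cases[OF p])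
    then show ?thesis
      using type_prod_coset_type[OF G0 C(1)] type_prod_coset_type[OF C(1) G0]
        Q.l_one[of C] Q.r_one[of C] by (simp add: carr)
  qed
  \<comment> \<open>Transport along the isomorphism yields a group whose unit is the image of
    \<open>G0\<close>; the definite description in \<open>generic_type_group\<close> has to be
    evaluated to that element.\<close>
  have "one (generic_type_group G B) = coset_type G0"
    unfolding generic_type_group_def monoid.simps
  proof (rule the_equality)
    fix e
    assume e: "e \<in> generic_types G B \<and>
        (\<forall>p\<in>generic_types G B. type_prod G B e p = p \<and> type_prod G B p e = p)"
    then have "type_prod G B e (coset_type G0) = coset_type G0"
      using coset_type_generic[OF G0] by blast
    then show "e = coset_type G0" using unit e by metis
  qed (use unit coset_type_generic[OF G0] in blast)
  then have "(generic_type_group G B)\<lparr>one := coset_type \<one>\<^bsub>G LMod G0\<^esub>\<rparr> = generic_type_group G B"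
    by (simp add: carr generic_type_group_def)
  then show "group (generic_type_group G B)"
    using Q.iso_imp_img_group[OF iso] by simp
qed

lemma type_stab_eq:
  assumes p: "p \<in> generic_types G B"
  shows "type_stab G p = G0"
proof -
  obtain a where a: "a \<in> type_coset G G0 p" using type_coset_nonempty[OF p] by blast
  obtain C where C: "C \<in> lcosets G0" "type_coset G G0 p = C" by (rule generic_type_cases[OF p])
  have aG: "a \<in> carrier G"
    using a C stable_carrier[OF measure_lcoset_G0(1)[OF C(1)]] by blast
  have "conjugate G a G0 = G0"
    using aG subgroup.subset[OF subgroup_G0] normal.coset_eq[OF G0_normal]
    by (simp add: conjugate_def coset_mult_assoc flip: normal.coset_eq[OF G0_normal])
  then show ?thesis using type_stab_eq_conjugate[OF p a] by simp
qed

end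

theorem theorem5p4:
  fixes G :: "('a, 'b) monoid_scheme"
    and B :: "'a set set"
    and \<mu> :: "'a set \<Rightarrow> real"
  assumes "group G"
    and "B \<subseteq> stable_sets G"
    and "left_invariant_algebra G B"
    and "finite (lcosets\<^bsub>G\<^esub> component G B)"
    and "bi_invariant_probability G \<mu>"
  shows "let G0 = component G B; Bs = bi_invariant_hull G B in
    \<comment> \<open>(1)(a)\<close>
    (bij_betw (type_coset G G0) (generic_types G B) (lcosets\<^bsub>G\<^esub> G0) \<and>
     (\<forall>g\<in>carrier G. \<forall>p\<in>generic_types G B.
        type_act G g p \<in> generic_types G B \<and>
        type_coset G G0 (type_act G g p) = g <#\<^bsub>G\<^esub> type_coset G G0 p)) \<and>
    \<comment> \<open>(1)(b)\<close>
    (\<forall>p\<in>generic_types G B.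
       (\<exists>a\<in>type_coset G G0 p. type_stab G p = conjugate G a G0) \<and>
       (\<forall>a\<in>type_coset G G0 p. type_stab G p = conjugate G a G0)) \<and>
    \<comment> \<open>(2)\<close>
    (\<forall>X\<in>B.
       (\<forall>C\<in>lcosets\<^bsub>G\<^esub> G0. \<mu> (C \<inter> X) = 0 \<or> \<mu> (C - X) = 0) \<and>
       (let \<C> = {C \<in> lcosets\<^bsub>G\<^esub> G0. \<mu> (C \<inter> X) > 0}; Y = \<Union>\<C> in
          \<mu> X = \<mu> Y \<and> \<mu> Y = real (card \<C>) / real (card (lcosets\<^bsub>G\<^esub> G0)))) \<and>
    \<comment> \<open>(3)\<close>
    ((\<forall>X\<in>B. finite_index_subgroup G (measure_stab G \<mu> X) \<and> measure_stab G \<mu> X \<in> Bs) \<and>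
     component G Bs = (\<Inter>a\<in>carrier G. conjugate G a G0) \<and>
     component G Bs = (\<Inter>p\<in>generic_types G B. type_stab G p) \<and>
     component G Bs = (\<Inter>X\<in>B. measure_stab G \<mu> X) \<and>
     finite_index_subgroup G (component G Bs) \<and>
     component G Bs \<lhd> G \<and>
     component G Bs \<in> Bs) \<and>
    \<comment> \<open>(4)\<close>
    (bi_invariant_algebra G B \<longrightarrow>
       G0 \<lhd> G \<and>
       group (generic_type_group G B) \<and>
       type_coset G G0 \<in> iso (generic_type_group G B) (G LMod G0) \<and>
       (\<forall>p\<in>generic_types G B. type_stab G p = G0) \<and>
       (\<forall>X\<in>B. finite_index_subgroup G (measure_stab G \<mu> X) \<and> measure_stab G \<mu> X \<in> B))"
proof -
  interpret stable_algebra_prob G \<mu> B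
    using assms by (simp add: stable_algebra_prob_def stable_prob_def stable_prob_axioms_def
        stable_algebra_prob_axioms_def)
  have support: "\<mu> X = \<mu> (\<Union>{C \<in> lcosets\<^bsub>G\<^esub> G0. 0 < \<mu> (C \<inter> X)})"
    "\<mu> (\<Union>{C \<in> lcosets\<^bsub>G\<^esub> G0. 0 < \<mu> (C \<inter> X)}) =
      card {C \<in> lcosets\<^bsub>G\<^esub> G0. 0 < \<mu> (C \<inter> X)} / card (lcosets\<^bsub>G\<^esub> G0)" if X: "X \<in> B" for X
    using coset_support[OF G0_finite_index B_stableD[OF G0_B] B_stableD[OF X] G0_unsplit[OF X]]
      aeq_measure[OF B_stableD[OF X]] by (simp_all add: coset_support_def)
  have stab: "\<exists>a\<in>type_coset G G0 p. type_stab G p = conjugate G a G0"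
    if "p \<in> generic_types G B" for p
    using type_coset_nonempty[OF that] type_stab_eq_conjugate[OF that] by blast
  have bi: "G0 \<lhd> G \<and>
       group (generic_type_group G B) \<and>
       type_coset G G0 \<in> iso (generic_type_group G B) (G LMod G0) \<and>
       (\<forall>p\<in>generic_types G B. type_stab G p = G0) \<and>
       (\<forall>X\<in>B. finite_index_subgroup G (measure_stab G \<mu> X) \<and> measure_stab G \<mu> X \<in> B)"
    if "bi_invariant_algebra G B"
  proof -
    interpret bi: bi_stable_algebra_prob G \<mu> B
      using that by unfold_locales
    show ?thesis
      using bi.G0_normal bi.group_generic_type_group bi.coset_type_iso(2) bi.type_stab_eq
        measure_stab_finite_index bi.hull_eq by simp
  qed
  show ?thesis
    \<comment> \<open>Rewriting both the component of the hull and the intersection of conjugates to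
      \<open>core\<close> turns the first equality of (3) into a reflexivity and the others into the
      two intersection lemmas.\<close>
    unfolding Let_def component_hull core_def[symmetric]
    using bij_betw_type_coset type_act_generic stab type_stab_eq_conjugate G0_unsplit support
      measure_stab_finite_index(2,3) core_eq_Inter_type_stab core_eq_Inter_measure_stab
      core_finite_index core_normal core_hull bi
    by (intro conjI ballI impI) (assumption | blast | simp)+
qed

end
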